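(* Consider an $\mathrm{M^T/G/1}$ queue with primary arrival rate $\lambda>0$ whose triggering delay $Y\ge 0$ has a non-degenerate distribution (that is, $Y$ is not almost surely equal to a constant), with the arrival streams taken under stationarity. Then: (i) the marginal arrival process of primary ($\mathrm{C_P}$) customers is a Poisson process; (ii) the marginal arrival process of secondary ($\mathrm{C_S}$) customers is a Poisson process; (iii) the aggregate arrival process, i.e. the superposition of the arrival processes of $\mathrm{C_P}$ and $\mathrm{C_S}$ customers, is not a renewal process.
   Context: The $\mathrm{M^T/G/1}$ queue is a single-server first-come-first-served queue with infinite buffer and two customer classes. Primary customers ($\mathrm{C_P}$) arrive according to a homogeneous Poisson process with rate $\lambda>0$. Each primary customer triggers exactly one secondary customer ($\mathrm{C_S}$), which arrives at the queue after a random triggering delay: the secondary customer triggered by the primary customer with arrival epoch $T_i$ arrives at $T_i+Y_i$. The triggering delays $(Y_i)$ are i.i.d. copies of a proper (finite-valued) non-negative random variable $Y$ with distribution function $F_Y(y)=\mathbb{P}(Y\le y)$, and are independent of the primary arrival process and of all service times. Service times are i.i.d. within each class, with general class-dependent distributions; they play no role in the arrival streams. Stationarity: the primary Poisson process $\{T_i\}$ is taken on the whole real line, so that the arrival processes on $(0,\infty)$ also include those secondary customers whose primary customers arrived before time $0$. The aggregate arrival process is the point process consisting of all points $T_i$ and all points $T_i+Y_i$, counted with multiplicity; $N(t)$ denotes the number of its points in $(0,t]$. Renewal process: in this stationary setting, the aggregate process is called a renewal process if it is a stationary renewal process, i.e. its successive points in $(0,\infty)$ are $S_1\le S_2\le\cdots$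 where $S_1, S_2-S_1, S_3-S_2,\dots$ are independent, the variables $S_{k+1}-S_k$ ($k\ge1$) are identically distributed with some distribution $G$ on $[0,\infty)$ with finite positive mean $\mu$, and $S_1$ has the equilibrium density $(1-G(x))/\mu$, $x>0$. *)

theory Defs
  imports "HOL-Probability.Probability"
begin

text \<open>
  A point process on the real line is a family \<open>X :: 'i \<Rightarrow> 'a \<Rightarrow> real\<close> of random
  points. The enumeration carries no order, and distinct indices may give the same point, so that
  points are counted with multiplicity. The value on infinitely many points is the junk value
  \<open>card _ = 0\<close>; the processes below are required to be locally finite almost surely.
\<close>

definition point_count :: "('i \<Rightarrow> 'a \<Rightarrow> real) \<Rightarrow> real set \<Rightarrow> 'a \<Rightarrow> nat" where
  "point_count X B \<omega> = card {i. X i \<omega> \<in> B}"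

text \<open>
  The Poisson probabilities are written out because the library's \<open>poisson_pmf\<close> is unspecified
  for parameter \<open>0\<close>, which occurs here for null sets. Measurability of the counts is part of
  \<open>indep_vars\<close>.
\<close>

definition (in prob_space) poisson_process :: "real \<Rightarrow> ('i \<Rightarrow> 'a \<Rightarrow> real) \<Rightarrow> bool" where
  "poisson_process r X \<longleftrightarrow>
     0 < r \<and>
     (\<forall>B. B \<in> sets borel \<and> bounded B \<longrightarrow>
        (AE \<omega> in M. finite {i. X i \<omega> \<in> B}) \<and>
        (\<forall>k. prob {\<omega> \<in> space M. point_count X B \<omega> = k} =
              (r * measure lborel B) ^ k / fact k * exp (- (r * measure lborel B)))) \<and>
     (\<forall>(n::nat) B. (\<forall>j<n. B j \<in> sets borel \<and> bounded (B j)) \<and> disjoint_family_on B {..<n} \<longrightarrow>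
        indep_vars (\<lambda>_. count_space UNIV) (\<lambda>j. point_count X (B j)) {..<n})"

definition (in prob_space) iid :: "('i \<Rightarrow> 'a \<Rightarrow> real) \<Rightarrow> real measure \<Rightarrow> bool" where
  "iid X D \<longleftrightarrow> indep_vars (\<lambda>_. borel) X UNIV \<and> (\<forall>i. distr M borel (X i) = D)"

text \<open>
  \<open>T i\<close> is the epoch of the \<open>i\<close>-th primary arrival, \<open>Y i\<close> the delay with which it
  triggers its secondary customer, and \<open>U i\<close>, \<open>V i\<close> are the service times of these two
  customers. Indexing by \<open>int\<close> reflects that the process is taken on the whole line; the
  points \<open>T i\<close> need not be increasing in \<open>i\<close>. Independence of the delays from the rest
  is independence of the generated sigma-algebras, because \<open>indep_var\<close> forces both random
  elements to have the same type; that \<open>T\<close>, \<open>U\<close>, \<open>V\<close> are measurable is part of it.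
\<close>

locale MTG1_queue = prob_space M
  for M :: "'a measure" +
  fixes rate :: real
    and T Y U V :: "int \<Rightarrow> 'a \<Rightarrow> real"
    and F\<^sub>Y F\<^sub>U F\<^sub>V :: "real measure"
  assumes primary: "poisson_process rate T"
    and delay_iid: "iid Y F\<^sub>Y"
    and delay_nonneg: "AE y in F\<^sub>Y. 0 \<le> y"
    and primary_service_iid: "iid U F\<^sub>U"
    and primary_service_nonneg: "AE u in F\<^sub>U. 0 \<le> u"
    and secondary_service_iid: "iid V F\<^sub>V"
    and secondary_service_nonneg: "AE v in F\<^sub>V. 0 \<le> v"
    and delay_indep:
      "indep_set
         (sets (vimage_algebra (space M) (\<lambda>\<omega> i. Y i \<omega>) (\<Pi>\<^sub>M i\<in>UNIV. borel)))
         (sets (vimage_algebra (space M)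
            (\<lambda>\<omega>. (\<lambda>i. T i \<omega>, \<lambda>i. U i \<omega>, \<lambda>i. V i \<omega>))
            ((\<Pi>\<^sub>M i\<in>UNIV. borel) \<Otimes>\<^sub>M (\<Pi>\<^sub>M i\<in>UNIV. borel) \<Otimes>\<^sub>M (\<Pi>\<^sub>M i\<in>UNIV. borel))))"

definition secondary_arrivals ::
    "('i \<Rightarrow> 'a \<Rightarrow> real) \<Rightarrow> ('i \<Rightarrow> 'a \<Rightarrow> real) \<Rightarrow> 'i \<Rightarrow> 'a \<Rightarrow> real" where
  "secondary_arrivals T Y i \<omega> = T i \<omega> + Y i \<omega>"

definition superposition ::
    "('i \<Rightarrow> 'a \<Rightarrow> real) \<Rightarrow> ('j \<Rightarrow> 'a \<Rightarrow> real) \<Rightarrow> 'i + 'j \<Rightarrow> 'a \<Rightarrow> real" where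
  "superposition X Z = case_sum X Z"

text \<open>
  \<open>s 0 \<le> s 1 \<le> \<dots>\<close> lists all points of the configuration \<open>x\<close> in \<open>(0, \<infinity>)\<close>,
  each as often as its multiplicity.
\<close>

definition successive_points :: "('i \<Rightarrow> real) \<Rightarrow> (nat \<Rightarrow> real) \<Rightarrow> bool" where
  "successive_points x s \<longleftrightarrow>
     incseq s \<and> (\<exists>\<pi>. bij_betw \<pi> UNIV {i. 0 < x i} \<and> (\<forall>k. s k = x (\<pi> k)))"

text \<open>
  Indices are shifted by one: \<open>S 0\<close> is the first point in \<open>(0, \<infinity>)\<close>, and it has the
  equilibrium distribution of \<open>G\<close>.
\<close>

definition (in prob_space) stationary_renewal_process :: "('i \<Rightarrow> 'a \<Rightarrow> real) \<Rightarrow> bool" where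
  "stationary_renewal_process X \<longleftrightarrow>
     (\<exists>(S :: nat \<Rightarrow> 'a \<Rightarrow> real) (G :: real measure) \<mu>.
        (AE \<omega> in M. successive_points (\<lambda>i. X i \<omega>) (\<lambda>k. S k \<omega>)) \<and>
        indep_vars (\<lambda>_. borel)
          (\<lambda>k \<omega>. case k of 0 \<Rightarrow> S 0 \<omega> | Suc j \<Rightarrow> S (Suc j) \<omega> - S j \<omega>) UNIV \<and>
        real_distribution G \<and> (AE x in G. 0 \<le> x) \<and>
        integrable G (\<lambda>x. x) \<and> \<mu> = (\<integral>x. x \<partial>G) \<and> 0 < \<mu> \<and>
        (\<forall>k. distr M borel (\<lambda>\<omega>. S (Suc k) \<omega> - S k \<omega>) = G) \<and>
        distributed M lborel (S 0)
          (\<lambda>x. ennreal (indicator {0<..} x * ((1 - cdf G x) / \<mu>))))"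

end

theory Submission
  imports Defs
begin

text \<open>
  The primary stream is Poisson by assumption. For the secondary stream, a family of points
  \<open>X i\<close> is described by the product functional that sends a measurable
  \<open>f :: real \<Rightarrow> real\<close> with values in \<open>[0,1]\<close> to the limit of the expectations of
  \<open>\<Prod>i\<in>window n. f (X i)\<close>. Its value is \<open>exp (- r * (\<integral>x. 1 - f x))\<close> for
  every such \<open>f\<close> with integrable \<open>1 - f\<close> if \<open>X\<close> is a Poisson process of rate
  \<open>r\<close> (\<open>poisson_process_functional\<close>), and conversely these values, even for step
  functions only, determine the joint law of the counts (\<open>poisson_processI\<close>). Since the
  delays are independent and identically distributed and independent of the primary epochs, they
  can be integrated out factor by factor (\<open>marked_poisson_functional\<close>): displacing the points
  replaces \<open>f\<close> by its average over random shifts. Translation invariance of Lebesgue measure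
  leaves the integral of \<open>1 - f\<close> unchanged, so the displaced points form a Poisson process of
  the same rate (\<open>displaced_poisson_process\<close>).

  The same functional gives the probability that the aggregate process has no point in a bounded
  set \<open>B\<close>: it is \<open>exp (- r * (2 * \<bar>B\<bar> - o B))\<close> with \<open>o B\<close> the mean overlap of
  \<open>B\<close> with its shift by a random delay (\<open>void_probability\<close>). In a stationary renewal process the
  first point after \<open>0\<close> is independent of the points that follow, seen from it. Hence the
  density of the event that the first point is at \<open>s\<close> and the next stretch of length
  \<open>t\<close> is empty is a function of \<open>s\<close> times a function of \<open>t\<close>
  (\<open>antitone_density_sandwich\<close>, \<open>sandwich_limit_product\<close>). For the aggregate process this density
  is obtained by differentiating void probabilities
  (\<open>void_difference_right_derivative\<close>); with \<open>F\<close> the distribution function of the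
  delay and \<open>p x\<close> the probability of an empty interval of length \<open>x\<close> it is
  \<open>r * p (s + t) * (2 - F s - F t + F 0)\<close>. Such an expression factorizes only if
  \<open>F 0 = 1\<close> (\<open>void_product_impossible\<close>): the limit \<open>t \<rightarrow> \<infinity>\<close> determines
  \<open>p\<close> in terms of \<open>F\<close>, and the derivative at \<open>t = 0\<close> then leaves only the
  values \<open>F 0\<close> and \<open>1\<close> for \<open>F\<close>, which is impossible near \<open>0\<close>.
  A non-degenerate delay has \<open>F 0 < 1\<close>.
\<close>

section \<open>Joint laws of counts from their generating function\<close>

lemma power_series_zero:
  fixes d :: "nat \<Rightarrow> real"
  assumes sums: "\<And>x. 0 < x \<Longrightarrow> x \<le> 1 \<Longrightarrow> (\<lambda>k. d k * x ^ k) sums 0"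
  shows "d n = 0"
proof (induction n rule: less_induct)
  case (less n)
  have shift: "(\<lambda>k. d (k + n) * x ^ k) sums 0" if x: "0 < x" "x \<le> 1" for x
  proof -
    have "(\<lambda>k. d (k + n) * x ^ (k + n)) sums (0 - (\<Sum>k<n. d k * x ^ k))"
      by (rule sums_split_initial_segment[OF sums[OF x]])
    also have "(\<Sum>k<n. d k * x ^ k) = 0"
      using less by simp
    finally have "(\<lambda>k. (d (k + n) * x ^ (k + n)) * (1 / x ^ n)) sums (0 * (1 / x ^ n))"
      by (intro sums_mult2) simp
    then show ?thesis
      using x by (simp add: power_add field_simps)
  qed
  have conv: "summable (\<lambda>k. d (k + n) * x ^ k)" if "norm x < 1" for x :: real
    using powser_inside[of "\<lambda>k. d (k + n)" 1 x] shift[of 1] that by (auto simp: sums_iff)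
  have "((\<lambda>x. \<Sum>k. d (k + n) * x ^ k) \<longlongrightarrow> d (0 + n)) (at 0)"
    by (rule powser_limit_0[where s=1]) (use conv in \<open>auto simp: summable_sums\<close>)
  then have "((\<lambda>x. \<Sum>k. d (k + n) * x ^ k) \<longlongrightarrow> d (0 + n)) (at_right 0)"
    by (rule filterlim_mono) (auto simp: at_within_le_nhds at_le)
  moreover have "((\<lambda>x. \<Sum>k. d (k + n) * x ^ k) \<longlongrightarrow> 0) (at_right 0)"
    by (rule tendsto_eventually)
       (use shift in \<open>auto simp: eventually_at_right_field sums_iff intro!: exI[of _ 1]\<close>)
  ultimately show ?case
    using tendsto_unique[OF trivial_limit_at_right_real] by fastforce
qed

text \<open>
  A generating function is known on \<open>[0,1]\<close> only, and this already determines its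
  coefficients.
\<close>

lemma power_series_unique:
  fixes a b :: "nat \<Rightarrow> real"
  assumes "\<And>x. 0 \<le> x \<Longrightarrow> x \<le> 1 \<Longrightarrow> (\<lambda>k. a k * x ^ k) sums s x"
    and "\<And>x. 0 \<le> x \<Longrightarrow> x \<le> 1 \<Longrightarrow> (\<lambda>k. b k * x ^ k) sums s x"
  shows "a k = b k"
proof -
  have "(\<lambda>k. (a k - b k) * x ^ k) sums 0" if "0 < x" "x \<le> 1" for x
    using sums_diff[OF assms(1)[of x] assms(2)[of x]] that by (simp add: left_diff_distrib)
  from power_series_zero[of "\<lambda>k. a k - b k", OF this] show ?thesis
    by simp
qed

context prob_space
begin

text \<open>
  The weight \<open>W\<close> allows the same expansion to be used in one coordinate while the other
  coordinates of a random vector are kept as factors of \<open>W\<close>.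
\<close>

lemma expectation_power_sums:
  fixes N :: "'a \<Rightarrow> nat" and W :: "'a \<Rightarrow> real"
  assumes [measurable]: "N \<in> measurable M (count_space UNIV)" "W \<in> borel_measurable M"
    and W: "\<And>\<omega>. 0 \<le> W \<omega>" "\<And>\<omega>. W \<omega> \<le> 1" and z: "0 \<le> z" "z \<le> 1"
  shows "(\<lambda>k. expectation (\<lambda>\<omega>. W \<omega> * of_bool (N \<omega> = k)) * z ^ k)
           sums expectation (\<lambda>\<omega>. W \<omega> * z ^ N \<omega>)"
proof -
  have partial: "(\<Sum>k<n. W \<omega> * of_bool (N \<omega> = k) * z ^ k) = W \<omega> * of_bool (N \<omega> < n) * z ^ N \<omega>" for n \<omega>
  proof -
    have "(\<Sum>k<n. W \<omega> * of_bool (N \<omega> = k) * z ^ k) = (\<Sum>k<n. if k = N \<omega> then W \<omega> * z ^ k else 0)"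
      by (intro sum.cong) auto
    then show ?thesis by (simp add: sum.delta)
  qed
  have int: "integrable M (\<lambda>\<omega>. W \<omega> * of_bool (N \<omega> = k))" for k
    by (rule integrable_const_bound[where B=1]) (use W in \<open>auto simp: mult_le_one\<close>)
  have "(\<lambda>n. expectation (\<lambda>\<omega>. \<Sum>k<n. W \<omega> * of_bool (N \<omega> = k) * z ^ k))
          \<longlonglongrightarrow> expectation (\<lambda>\<omega>. W \<omega> * z ^ N \<omega>)"
  proof (rule integral_dominated_convergence[where w="\<lambda>_. 1"])
    show "AE \<omega> in M. (\<lambda>n. \<Sum>k<n. W \<omega> * of_bool (N \<omega> = k) * z ^ k) \<longlonglongrightarrow> W \<omega> * z ^ N \<omega>"
    proof (rule AE_I2, rule tendsto_eventually)
      fix \<omega>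
      show "\<forall>\<^sub>F n in sequentially. (\<Sum>k<n. W \<omega> * of_bool (N \<omega> = k) * z ^ k) = W \<omega> * z ^ N \<omega>"
        using eventually_gt_at_top[of "N \<omega>"] by eventually_elim (simp add: partial)
    qed
    show "AE \<omega> in M. norm (\<Sum>k<n. W \<omega> * of_bool (N \<omega> = k) * z ^ k) \<le> 1" for n
      unfolding partial using W z by (auto simp: abs_mult mult_le_one power_le_one)
  qed auto
  moreover have "expectation (\<lambda>\<omega>. \<Sum>k<n. W \<omega> * of_bool (N \<omega> = k) * z ^ k)
      = (\<Sum>k<n. expectation (\<lambda>\<omega>. W \<omega> * of_bool (N \<omega> = k)) * z ^ k)" for n
    using int by (subst Bochner_Integration.integral_sum) auto
  ultimately show ?thesis
    by (simp add: sums_def)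
qed

text \<open>
  Uniqueness of a generating function in several variables reduces to one variable: the powers
  \<open>z j ^ N j\<close> are replaced by the events \<open>N j = k j\<close> one coordinate at a time, each
  time comparing the coefficients of a power series in \<open>z j\<close>.
\<close>

lemma joint_law_from_generating_function:
  fixes N :: "nat \<Rightarrow> 'a \<Rightarrow> nat" and p :: "nat \<Rightarrow> nat \<Rightarrow> real"
  assumes meas: "\<And>j. j < n \<Longrightarrow> N j \<in> measurable M (count_space UNIV)"
    and p: "\<And>j x. j < n \<Longrightarrow> 0 \<le> x \<Longrightarrow> x \<le> 1 \<Longrightarrow> (\<lambda>k. p j k * x ^ k) sums P j x"
    and pgf: "\<And>z. (\<forall>j<n. 0 \<le> z j \<and> z j \<le> 1) \<Longrightarrow>
      expectation (\<lambda>\<omega>. \<Prod>j<n. z j ^ N j \<omega>) = (\<Prod>j<n. P j (z j))"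
  shows "prob {\<omega>\<in>space M. \<forall>j<n. N j \<omega> = k j} = (\<Prod>j<n. p j (k j))"
proof -
  have step: "expectation (\<lambda>\<omega>. (\<Prod>j<m. of_bool (N j \<omega> = k j)) * (\<Prod>j\<in>{m..<n}. z j ^ N j \<omega>))
      = (\<Prod>j<m. p j (k j)) * (\<Prod>j\<in>{m..<n}. P j (z j))"
    if "m \<le> n" "\<forall>j<n. 0 \<le> z j \<and> z j \<le> 1" for m z
    using that
  proof (induction m arbitrary: z)
    case 0
    then show ?case using pgf[of z] by (simp add: atLeast0LessThan)
  next
    case (Suc m)
    then have m: "m < n" by simp
    define W where "W \<omega> = (\<Prod>j<m. of_bool (N j \<omega> = k j)) * (\<Prod>j\<in>{Suc m..<n}. z j ^ N j \<omega>)" for \<omega>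
    define C where "C = (\<Prod>j<m. p j (k j)) * (\<Prod>j\<in>{Suc m..<n}. P j (z j))"
    have [measurable]: "W \<in> borel_measurable M"
      unfolding W_def using m
      by (intro borel_measurable_times borel_measurable_prod measurable_compose[OF meas]) auto
    have W: "0 \<le> W \<omega>" "W \<omega> \<le> 1" for \<omega>
      unfolding W_def using Suc.prems
      by (auto intro!: mult_nonneg_nonneg mult_le_one prod_nonneg prod_le_1 power_le_one)
    have split: "{m..<n} = insert m {Suc m..<n}" using m by auto
    have "(\<lambda>i. expectation (\<lambda>\<omega>. W \<omega> * of_bool (N m \<omega> = i)) * x ^ i) sums (C * P m x)"
      if x: "0 \<le> x" "x \<le> 1" for x
    proof -
      have "expectation (\<lambda>\<omega>. W \<omega> * x ^ N m \<omega>) = C * P m x"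
      proof -
        have 1: "(\<Prod>j\<in>{Suc m..<n}. (z(m := x)) j ^ N j \<omega>) = (\<Prod>j\<in>{Suc m..<n}. z j ^ N j \<omega>)" for \<omega>
          by (intro prod.cong) auto
        have 2: "(\<Prod>j\<in>{Suc m..<n}. P j ((z(m := x)) j)) = (\<Prod>j\<in>{Suc m..<n}. P j (z j))"
          by (intro prod.cong) auto
        show ?thesis
          using Suc.IH[of "z(m := x)"] Suc.prems x
          unfolding split by (simp add: W_def C_def 1 2 mult_ac del: fun_upd_apply) (simp add: mult_ac)
      qed
      then show ?thesis
        using expectation_power_sums[OF meas[OF m] \<open>W \<in> borel_measurable M\<close> W x] by simp
    qed
    moreover have "(\<lambda>i. (C * p m i) * x ^ i) sums (C * P m x)" if "0 \<le> x" "x \<le> 1" for x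
      using sums_mult[OF p[OF m that], of C] by (simp add: mult_ac)
    ultimately have "expectation (\<lambda>\<omega>. W \<omega> * of_bool (N m \<omega> = k m)) = C * p m (k m)"
      by (rule power_series_unique)
    then show ?case
      by (simp add: W_def C_def mult_ac)
  qed
  have "Measurable.pred M (\<lambda>\<omega>. \<forall>j\<in>{..<n}. N j \<omega> = k j)"
    by (intro pred_intros_finite measurable_compose[OF meas]) auto
  then have [measurable]: "Measurable.pred M (\<lambda>\<omega>. \<forall>j<n. N j \<omega> = k j)"
    by (simp only: Ball_def lessThan_iff)
  have "(\<Prod>j<n. of_bool (N j \<omega> = k j)) = (indicator {\<omega>. \<forall>j<n. N j \<omega> = k j} \<omega> :: real)" for \<omega>
    by (induction n) (auto simp: less_Suc_eq indicator_def)
  then have "expectation (\<lambda>\<omega>. \<Prod>j<n. of_bool (N j \<omega> = k j)) = prob {\<omega>\<in>space M. \<forall>j<n. N j \<omega> = k j}"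
    by (simp add: Int_def conj_commute)
  with step[of n "\<lambda>_. 0"] show ?thesis by simp
qed

end

section \<open>Poisson processes and products over their points\<close>

text \<open>
  The points of a process indexed by \<open>int\<close> are exhausted by finite index sets, so that
  an infinite product over the points is a limit of finite ones.
\<close>

definition window :: "nat \<Rightarrow> int set" where
  "window n = {- int n..int n}"

lemma finite_window [simp]: "finite (window n)"
  by (simp add: window_def)

lemma window_mono: "m \<le> n \<Longrightarrow> window m \<subseteq> window n"
  by (auto simp: window_def)

lemma finite_subset_window:
  assumes "finite I"
  obtains n where "I \<subseteq> window n"
proof
  show "I \<subseteq> window (nat (\<Sum>i\<in>I. \<bar>i\<bar>))"
  proof
    fix i assume "i \<in> I"
    then have "\<bar>i\<bar> \<le> (\<Sum>i\<in>I. \<bar>i\<bar>)"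
      using assms by (intro member_le_sum) auto
    then show "i \<in> window (nat (\<Sum>i\<in>I. \<bar>i\<bar>))"
      by (auto simp: window_def)
  qed
qed

lemma in_window_of_large_index: "i \<in> window n" if "nat \<bar>i\<bar> \<le> n"
  using that by (auto simp: window_def)

lemma finite_iff_outside_window:
  "finite {i::int. P i} \<longleftrightarrow> (\<exists>n. \<forall>i. i \<notin> window n \<longrightarrow> \<not> P i)"
proof
  assume "finite {i. P i}"
  then obtain n where "{i. P i} \<subseteq> window n" by (rule finite_subset_window)
  then show "\<exists>n. \<forall>i. i \<notin> window n \<longrightarrow> \<not> P i" by blast
next
  assume "\<exists>n. \<forall>i. i \<notin> window n \<longrightarrow> \<not> P i"
  then obtain n where "{i. P i} \<subseteq> window n" by blast
  then show "finite {i. P i}" using finite_subset finite_window by blast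
qed

text \<open>
  For disjoint \<open>B j\<close> this is the function that equals \<open>c j\<close> on \<open>B j\<close> and
  \<open>1\<close> elsewhere. In product form, its product over all points of a configuration is
  visibly the monomial in the counts of the sets \<open>B j\<close>.
\<close>

definition step_function :: "nat \<Rightarrow> (nat \<Rightarrow> real) \<Rightarrow> (nat \<Rightarrow> real set) \<Rightarrow> real \<Rightarrow> real" where
  "step_function m c B x = (\<Prod>j<m. if x \<in> B j then c j else 1)"

lemma step_function_measurable [measurable]:
  assumes "\<And>j. j < m \<Longrightarrow> B j \<in> sets borel"
  shows "step_function m c B \<in> borel_measurable borel"
  unfolding step_function_def [abs_def]
  using assms by (intro borel_measurable_prod measurable_If) auto

lemma step_function_bounds:
  assumes "\<And>j. j < m \<Longrightarrow> 0 \<le> c j \<and> c j \<le> 1"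
  shows "0 \<le> step_function m c B x" "step_function m c B x \<le> 1"
  using assms by (auto simp: step_function_def intro!: prod_nonneg prod_le_1)

lemma prod_step_function:
  assumes "finite I"
  shows "(\<Prod>i\<in>I. step_function m c B (x i)) = (\<Prod>j<m. c j ^ card {i\<in>I. x i \<in> B j})"
proof -
  have "(\<Prod>i\<in>I. step_function m c B (x i)) = (\<Prod>j<m. \<Prod>i\<in>I. if x i \<in> B j then c j else 1)"
    unfolding step_function_def by (rule prod.swap)
  also have "\<dots> = (\<Prod>j<m. c j ^ card {i\<in>I. x i \<in> B j})"
    using assms by (simp add: prod.If_cases Int_def)
  finally show ?thesis .
qed

lemma prod_step_function_tendsto:
  fixes x :: "int \<Rightarrow> real"
  assumes fin: "\<And>j. j < m \<Longrightarrow> finite {i. x i \<in> B j}"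
  shows "(\<lambda>n. \<Prod>i\<in>window n. step_function m c B (x i))
           \<longlonglongrightarrow> (\<Prod>j<m. c j ^ card {i. x i \<in> B j})"
  unfolding prod_step_function[OF finite_window]
proof (rule tendsto_prod)
  fix j assume "j \<in> {..<m}"
  then obtain n0 where n0: "{i. x i \<in> B j} \<subseteq> window n0"
    using fin finite_subset_window by blast
  have "{i\<in>window n. x i \<in> B j} = {i. x i \<in> B j}" if "n0 \<le> n" for n
    using n0 window_mono[OF that] by auto
  then have "\<forall>\<^sub>F n in sequentially. c j ^ card {i\<in>window n. x i \<in> B j} = c j ^ card {i. x i \<in> B j}"
    by (intro eventually_sequentiallyI[of n0]) simp
  then show "(\<lambda>n. c j ^ card {i\<in>window n. x i \<in> B j}) \<longlonglongrightarrow> c j ^ card {i. x i \<in> B j}"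
    by (rule tendsto_eventually)
qed

lemma integral_one_minus_step_function:
  assumes B: "\<And>j. j < m \<Longrightarrow> B j \<in> sets borel \<and> bounded (B j)"
    and disj: "disjoint_family_on B {..<m}"
  shows "integrable lborel (\<lambda>x. 1 - step_function m c B x)"
    and "(\<integral>x. 1 - step_function m c B x \<partial>lborel) = (\<Sum>j<m. (1 - c j) * measure lborel (B j))"
proof -
  have eq: "1 - step_function m c B x = (\<Sum>j<m. (1 - c j) * indicator (B j) x)" for x
  proof (cases "\<exists>j<m. x \<in> B j")
    case True
    then obtain j where j: "j < m" "x \<in> B j" by auto
    have other: "x \<notin> B i" if "i < m" "i \<noteq> j" for i
      using disj j that by (auto simp: disjoint_family_on_def)
    have "step_function m c B x = (\<Prod>i<m. if i = j then c j else 1)"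
      unfolding step_function_def using j other by (intro prod.cong) auto
    moreover have "(\<Sum>i<m. (1 - c i) * indicator (B i) x) = (\<Sum>i<m. if i = j then 1 - c j else 0)"
      using j other by (intro sum.cong) auto
    ultimately show ?thesis
      using j by (simp add: prod.delta sum.delta)
  next
    case False
    then show ?thesis by (auto simp: step_function_def)
  qed
  have fin: "emeasure lborel (B j) < \<infinity>" if "j < m" for j
    using B[OF that] emeasure_bounded_finite by auto
  have int: "integrable lborel (\<lambda>x. (1 - c j) * indicator (B j) x)" if "j < m" for j
    using B fin that by (intro integrable_mult_right integrable_real_indicator) auto
  show "integrable lborel (\<lambda>x. 1 - step_function m c B x)"
    unfolding eq using int by (intro Bochner_Integration.integrable_sum) auto
  show "(\<integral>x. 1 - step_function m c B x \<partial>lborel) = (\<Sum>j<m. (1 - c j) * measure lborel (B j))"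
    unfolding eq using int B by (subst Bochner_Integration.integral_sum) auto
qed

context prob_space
begin

lemma measurable_point_count [measurable]:
  fixes X :: "int \<Rightarrow> 'a \<Rightarrow> real"
  assumes [measurable]: "\<And>i. X i \<in> borel_measurable M" and [measurable]: "B \<in> sets borel"
  shows "point_count X B \<in> measurable M (count_space UNIV)"
    and "Measurable.pred M (\<lambda>\<omega>. finite {i. X i \<omega> \<in> B})"
proof -
  show fin [measurable]: "Measurable.pred M (\<lambda>\<omega>. finite {i. X i \<omega> \<in> B})"
    unfolding finite_iff_outside_window by measurable
  define c where "c n \<omega> = (\<Sum>i\<in>window n. if X i \<omega> \<in> B then 1 else 0 :: nat)" for n \<omega>
  have c [measurable]: "c n \<in> measurable M (count_space UNIV)" for n
    unfolding c_def [abs_def] by measurable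
  have card: "c n \<omega> = card {i\<in>window n. X i \<omega> \<in> B}" for n \<omega>
    by (simp add: c_def sum.If_cases Int_def)
  have eq: "point_count X B \<omega> = k \<longleftrightarrow>
      (if finite {i. X i \<omega> \<in> B} then \<exists>n0. \<forall>n\<ge>n0. c n \<omega> = k else k = 0)" for \<omega> k
  proof (cases "finite {i. X i \<omega> \<in> B}")
    case True
    then obtain n0 where n0: "{i. X i \<omega> \<in> B} \<subseteq> window n0" by (rule finite_subset_window)
    have "{i\<in>window n. X i \<omega> \<in> B} = {i. X i \<omega> \<in> B}" if "n0 \<le> n" for n
      using n0 window_mono[OF that] by auto
    then have c_eq: "c n \<omega> = point_count X B \<omega>" if "n0 \<le> n" for n
      using that by (simp add: card point_count_def)
    then have "(\<exists>n0. \<forall>n\<ge>n0. c n \<omega> = k) \<longleftrightarrow> point_count X B \<omega> = k"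
      by (metis nle_le)
    with True show ?thesis by simp
  qed (auto simp: point_count_def)
  have "Measurable.pred M (\<lambda>\<omega>. point_count X B \<omega> = k)" for k
    unfolding eq by measurable
  then show "point_count X B \<in> measurable M (count_space UNIV)"
    by (intro measurable_count_space_eq2_countable[THEN iffD2]) (auto simp: pred_def vimage_def Int_def conj_commute)
qed

lemma poisson_generating_function:
  assumes meas: "N \<in> measurable M (count_space (UNIV :: nat set))"
    and law: "\<And>k. prob {\<omega>\<in>space M. N \<omega> = k} = a ^ k / fact k * exp (- a)"
    and z: "0 \<le> z" "z \<le> 1"
  shows "expectation (\<lambda>\<omega>. z ^ N \<omega>) = exp (- (1 - z) * a)"
proof -
  note [measurable] = meas
  have "(\<lambda>k. (a ^ k / fact k * exp (- a)) * z ^ k) sums expectation (\<lambda>\<omega>. z ^ N \<omega>)"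
  proof -
    have "expectation (\<lambda>\<omega>. 1 * (of_bool (N \<omega> = k) :: real)) = prob {\<omega>\<in>space M. N \<omega> = k}" for k
    proof -
      have "expectation (\<lambda>\<omega>. 1 * (of_bool (N \<omega> = k) :: real)) = expectation (indicator {\<omega>\<in>space M. N \<omega> = k})"
        by (intro Bochner_Integration.integral_cong) (auto simp: indicator_def of_bool_def)
      then show ?thesis by simp
    qed
    then show ?thesis
      using expectation_power_sums[OF meas, of "\<lambda>_. 1" z] z by (simp add: law)
  qed
  moreover have "(\<lambda>k. (a ^ k / fact k * exp (- a)) * z ^ k) sums (exp (a * z) * exp (- a))"
    using sums_mult2[OF exp_converges[of "a * z"], of "exp (- a)"]
    by (simp add: field_simps power_mult_distrib)
  ultimately have "expectation (\<lambda>\<omega>. z ^ N \<omega>) = exp (a * z) * exp (- a)"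
    by (rule sums_unique2)
  then show ?thesis
    by (simp add: exp_add [symmetric] algebra_simps)
qed

lemma window_products_tendsto_generating_function:
  fixes X :: "int \<Rightarrow> 'a \<Rightarrow> real"
  assumes [measurable]: "\<And>i. X i \<in> borel_measurable M" 
    and B [measurable]: "\<And>j. j < m \<Longrightarrow> B j \<in> sets borel"
    and fin: "\<And>j. j < m \<Longrightarrow> AE \<omega> in M. finite {i. X i \<omega> \<in> B j}"
    and c: "\<And>j. j < m \<Longrightarrow> 0 \<le> c j \<and> c j \<le> 1"
  shows "(\<lambda>n. expectation (\<lambda>\<omega>. \<Prod>i\<in>window n. step_function m c B (X i \<omega>)))
           \<longlonglongrightarrow> expectation (\<lambda>\<omega>. \<Prod>j<m. c j ^ point_count X (B j) \<omega>)"
proof (rule integral_dominated_convergence[where w="\<lambda>_. 1"])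
  show "AE \<omega> in M. (\<lambda>n. \<Prod>i\<in>window n. step_function m c B (X i \<omega>))
           \<longlonglongrightarrow> (\<Prod>j<m. c j ^ point_count X (B j) \<omega>)"
  proof -
    have "AE \<omega> in M. \<forall>j\<in>{..<m}. finite {i. X i \<omega> \<in> B j}"
      using fin by (intro AE_finite_allI) auto
    then show ?thesis
      unfolding point_count_def by eventually_elim (intro prod_step_function_tendsto, auto)
  qed
  show "AE \<omega> in M. norm (\<Prod>i\<in>window n. step_function m c B (X i \<omega>)) \<le> 1" for n
    using step_function_bounds[of m c B] c by (auto simp: abs_prod intro!: prod_le_1)
  show "random_variable borel (\<lambda>\<omega>. \<Prod>j<m. c j ^ point_count X (B j) \<omega>)"
    by (intro borel_measurable_prod) measurable
qed (auto intro!: borel_measurable_prod measurable_compose[OF _ step_function_measurable])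

lemma poisson_processD:
  assumes "poisson_process r X"
  shows "0 < r"
    and "B \<in> sets borel \<Longrightarrow> bounded B \<Longrightarrow> AE \<omega> in M. finite {i. X i \<omega> \<in> B}"
    and "B \<in> sets borel \<Longrightarrow> bounded B \<Longrightarrow> prob {\<omega> \<in> space M. point_count X B \<omega> = k} =
        (r * measure lborel B) ^ k / fact k * exp (- (r * measure lborel B))"
    and "(\<And>j. j < (n::nat) \<Longrightarrow> C j \<in> sets borel \<and> bounded (C j)) \<Longrightarrow> disjoint_family_on C {..<n} \<Longrightarrow>
        indep_vars (\<lambda>_. count_space UNIV) (\<lambda>j. point_count X (C j)) {..<n}"
proof -
  note X = assms[unfolded poisson_process_def]
  show "0 < r" using X by (rule conjunct1)
  note counts = X[THEN conjunct2, THEN conjunct1, rule_format, OF conjI]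
  show "B \<in> sets borel \<Longrightarrow> bounded B \<Longrightarrow> AE \<omega> in M. finite {i. X i \<omega> \<in> B}"
    by (rule conjunct1[OF counts])
  show "B \<in> sets borel \<Longrightarrow> bounded B \<Longrightarrow> prob {\<omega> \<in> space M. point_count X B \<omega> = k} =
        (r * measure lborel B) ^ k / fact k * exp (- (r * measure lborel B))"
    by (rule spec[OF conjunct2[OF counts]])
  show "(\<And>j. j < (n::nat) \<Longrightarrow> C j \<in> sets borel \<and> bounded (C j)) \<Longrightarrow> disjoint_family_on C {..<n} \<Longrightarrow>
        indep_vars (\<lambda>_. count_space UNIV) (\<lambda>j. point_count X (C j)) {..<n}"
    using X[THEN conjunct2, THEN conjunct2, THEN spec, of n, THEN spec, of C] by simp
qed

text \<open>
  By independence of the counts the expectation of the monomial in them is a product of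
  generating functions of Poisson laws, and the exponents add up to an integral.
\<close>

lemma poisson_process_step_functional:
  fixes X :: "int \<Rightarrow> 'a \<Rightarrow> real"
  assumes X: "poisson_process r X" and [measurable]: "\<And>i. X i \<in> borel_measurable M"
    and B: "\<And>j. j < m \<Longrightarrow> B j \<in> sets borel \<and> bounded (B j)"
    and disj: "disjoint_family_on B {..<m}"
    and c: "\<And>j. j < m \<Longrightarrow> 0 \<le> c j \<and> c j \<le> 1"
  shows "(\<lambda>n. expectation (\<lambda>\<omega>. \<Prod>i\<in>window n. step_function m c B (X i \<omega>)))
           \<longlonglongrightarrow> exp (- r * (\<integral>x. 1 - step_function m c B x \<partial>lborel))"
proof -
  have ind: "indep_vars (\<lambda>_. count_space UNIV) (\<lambda>j. point_count X (B j)) {..<m}"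
    using poisson_processD(4)[OF X] B disj by blast
  have "expectation (\<lambda>\<omega>. \<Prod>j<m. c j ^ point_count X (B j) \<omega>)
      = (\<Prod>j<m. expectation (\<lambda>\<omega>. c j ^ point_count X (B j) \<omega>))"
  proof (rule indep_vars_lebesgue_integral)
    show "indep_vars (\<lambda>_. borel) (\<lambda>j \<omega>. c j ^ point_count X (B j) \<omega>) {..<m}"
      by (rule indep_vars_compose2[OF ind]) auto
    show "integrable M (\<lambda>\<omega>. c j ^ point_count X (B j) \<omega>)" if "j \<in> {..<m}" for j
      using that c[of j] B[of j]
      by (intro integrable_const_bound[where B=1]) (auto simp: power_le_one)
  qed auto
  also have "\<dots> = (\<Prod>j<m. exp (- (1 - c j) * (r * measure lborel (B j))))"
  proof (intro prod.cong refl)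
    fix j assume "j \<in> {..<m}"
    then have j: "j < m" by simp
    then show "expectation (\<lambda>\<omega>. c j ^ point_count X (B j) \<omega>) = exp (- (1 - c j) * (r * measure lborel (B j)))"
      using B[OF j] c[OF j]
      by (intro poisson_generating_function poisson_processD(3)[OF X] measurable_point_count) auto
  qed
  also have "\<dots> = exp (- r * (\<Sum>j<m. (1 - c j) * measure lborel (B j)))"
    by (simp add: exp_sum [symmetric] sum_distrib_left sum_negf [symmetric] algebra_simps)
  also have "(\<Sum>j<m. (1 - c j) * measure lborel (B j)) = (\<integral>x. 1 - step_function m c B x \<partial>lborel)"
    using integral_one_minus_step_function(2)[OF B disj] by simp
  finally have E: "expectation (\<lambda>\<omega>. \<Prod>j<m. c j ^ point_count X (B j) \<omega>)
    = exp (- r * (\<integral>x. 1 - step_function m c B x \<partial>lborel))" .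
  show ?thesis
    unfolding E[symmetric]
    using B c by (intro window_products_tendsto_generating_function poisson_processD(2)[OF X]) auto
qed

text \<open>
  The product functional of step functions is the joint generating function of the counts of
  disjoint sets, provided that these are finite. Finiteness follows from the functional itself:
  for \<open>f = 1 - \<theta>\<close> on \<open>B\<close> the products tend to \<open>0\<close> wherever
  \<open>B\<close> contains infinitely many points, while their expectations have a limit that
  approaches \<open>1\<close> as \<open>\<theta>\<close> tends to \<open>0\<close>.
\<close>

lemma poisson_processI:
  fixes X :: "int \<Rightarrow> 'a \<Rightarrow> real"
  assumes r: "0 < r" and [measurable]: "\<And>i. X i \<in> borel_measurable M"
    and lim: "\<And>m c B. (\<And>j. j < m \<Longrightarrow> B j \<in> sets borel \<and> bounded (B j)) \<Longrightarrow>
      disjoint_family_on B {..<m} \<Longrightarrow> (\<And>j. j < m \<Longrightarrow> 0 \<le> c j \<and> c j \<le> 1) \<Longrightarrow>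
      (\<lambda>n. expectation (\<lambda>\<omega>. \<Prod>i\<in>window n. step_function m c B (X i \<omega>)))
           \<longlonglongrightarrow> exp (- r * (\<integral>x. 1 - step_function m c B x \<partial>lborel))"
  shows "poisson_process r X"
proof -
  have fin: "AE \<omega> in M. finite {i. X i \<omega> \<in> B}" if B: "B \<in> sets borel" "bounded B" for B
  proof -
    note [measurable] = B(1)
    define I where "I = {\<omega>\<in>space M. infinite {i. X i \<omega> \<in> B}}"
    have [measurable]: "I \<in> events" 
      unfolding I_def using measurable_point_count(2)[of X B] by measurable
    have bound: "prob I \<le> 1 - exp (- r * (\<theta> * measure lborel B))" if \<theta>: "0 < \<theta>" "\<theta> < 1" for \<theta>
    proof -
      define f where "f = step_function 1 (\<lambda>_. 1 - \<theta>) (\<lambda>_. B)"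
      have f01: "0 \<le> f x" "f x \<le> 1" for x
        using \<theta> by (auto simp: f_def intro!: step_function_bounds)
      have [measurable]: "f \<in> borel_measurable borel"
        unfolding f_def using B by (intro step_function_measurable) auto
      have lim': "(\<lambda>n. expectation (\<lambda>\<omega>. \<Prod>i\<in>window n. f (X i \<omega>))) \<longlonglongrightarrow> exp (- r * (\<theta> * measure lborel B))"
        using lim[of 1 "\<lambda>_. B" "\<lambda>_. 1 - \<theta>"] integral_one_minus_step_function(2)[of 1 "\<lambda>_. B" "\<lambda>_. 1 - \<theta>"] B \<theta>
        by (simp add: f_def disjoint_family_on_def)
      have int: "integrable M (\<lambda>\<omega>. \<Prod>i\<in>window n. f (X i \<omega>))" for n
        using f01 by (intro integrable_const_bound[where B=1]) (auto simp: abs_prod intro!: prod_le_1)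
      have zero: "(\<lambda>n. expectation (\<lambda>\<omega>. indicator I \<omega> * (\<Prod>i\<in>window n. f (X i \<omega>)))) \<longlonglongrightarrow> expectation (\<lambda>\<omega>. 0)"
      proof (rule integral_dominated_convergence[where w="\<lambda>_. 1"])
        show "AE \<omega> in M. norm (indicator I \<omega> * (\<Prod>i\<in>window n. f (X i \<omega>))) \<le> 1" for n
          using f01 by (auto simp: abs_mult abs_prod indicator_def intro!: prod_le_1)
        have "(\<lambda>n. (\<Prod>i\<in>window n. f (X i \<omega>))) \<longlonglongrightarrow> 0" if "\<omega> \<in> I" for \<omega>
        proof -
          have inf: "infinite {i. X i \<omega> \<in> B}" using that by (simp add: I_def)
          have eq: "(\<Prod>i\<in>window n. f (X i \<omega>)) = (1 - \<theta>) ^ card {i\<in>window n. X i \<omega> \<in> B}" for n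
            unfolding f_def by (simp add: prod_step_function)
          have "filterlim (\<lambda>n. card {i\<in>window n. X i \<omega> \<in> B}) at_top sequentially"
            unfolding filterlim_at_top
          proof
            fix k
            obtain J where J: "J \<subseteq> {i. X i \<omega> \<in> B}" "finite J" "card J = k"
              using infinite_arbitrarily_large[OF inf] by auto
            obtain n0 where n0: "J \<subseteq> window n0" using J(2) by (rule finite_subset_window)
            have "k \<le> card {i\<in>window n. X i \<omega> \<in> B}" if "n0 \<le> n" for n
              unfolding J(3)[symmetric] using J n0 window_mono[OF that] by (intro card_mono) auto
            then show "\<forall>\<^sub>F n in sequentially. k \<le> card {i\<in>window n. X i \<omega> \<in> B}"
              by (rule eventually_sequentiallyI)
          qed
          moreover have "(\<lambda>k. (1 - \<theta>) ^ k) \<longlonglongrightarrow> 0"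
            using \<theta> by (intro LIMSEQ_power_zero) auto
          ultimately show ?thesis
            unfolding eq by (rule filterlim_compose[rotated])
        qed
        then show "AE \<omega> in M. (\<lambda>n. indicator I \<omega> * (\<Prod>i\<in>window n. f (X i \<omega>))) \<longlonglongrightarrow> 0"
          by (intro AE_I2) (auto simp: indicator_def)
      qed auto
      have le: "expectation (\<lambda>\<omega>. \<Prod>i\<in>window n. f (X i \<omega>)) \<le>
          (1 - prob I) + expectation (\<lambda>\<omega>. indicator I \<omega> * (\<Prod>i\<in>window n. f (X i \<omega>)))" for n
      proof -
        have int2: "integrable M (\<lambda>\<omega>. indicator I \<omega> * (\<Prod>i\<in>window n. f (X i \<omega>)))"
          using f01 by (intro integrable_const_bound[where B=1])
            (auto simp: abs_mult abs_prod indicator_def intro!: prod_le_1)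
        have intI: "integrable M (indicator I :: 'a \<Rightarrow> real)"
          by (intro integrable_real_indicator) (auto simp: less_top [symmetric])
        have "expectation (\<lambda>\<omega>. \<Prod>i\<in>window n. f (X i \<omega>)) \<le>
          expectation (\<lambda>\<omega>. (1 - indicator I \<omega>) + indicator I \<omega> * (\<Prod>i\<in>window n. f (X i \<omega>)))"
        proof (rule integral_mono[OF int])
          show "integrable M (\<lambda>\<omega>. (1 - indicator I \<omega>) + indicator I \<omega> * (\<Prod>i\<in>window n. f (X i \<omega>)))"
            using int2 intI by (intro Bochner_Integration.integrable_add Bochner_Integration.integrable_diff) auto
          show "(\<Prod>i\<in>window n. f (X i \<omega>))
              \<le> (1 - indicator I \<omega>) + indicator I \<omega> * (\<Prod>i\<in>window n. f (X i \<omega>))" for \<omega>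
            using f01 by (cases "\<omega> \<in> I") (auto intro!: prod_le_1)
        qed
        also have "\<dots> = (1 - prob I) + expectation (\<lambda>\<omega>. indicator I \<omega> * (\<Prod>i\<in>window n. f (X i \<omega>)))"
          using int2 intI by (simp add: prob_space)
        finally show ?thesis .
      qed
      have "exp (- r * (\<theta> * measure lborel B)) \<le> (1 - prob I) + 0"
        using le by (intro LIMSEQ_le[OF lim' tendsto_add[OF tendsto_const, of _ 0]])
          (use zero in auto)
      then show ?thesis by simp
    qed
    have "((\<lambda>\<theta>. 1 - exp (- r * (\<theta> * measure lborel B))) \<longlongrightarrow> 1 - exp (- r * (0 * measure lborel B))) (at_right 0)"
      by (intro tendsto_intros)
    then have "prob I \<le> 1 - exp (- r * (0 * measure lborel B))"
      by (rule tendsto_lowerbound)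
         (use bound in \<open>auto simp: eventually_at_right_field intro!: exI[of _ 1]\<close>)
    then have "prob I = 0" using measure_nonneg[of M I] by simp
    then have "AE \<omega> in M. \<omega> \<notin> I"
      using prob_eq_0[OF \<open>I \<in> events\<close>] by simp
    then show ?thesis
      using AE_space by eventually_elim (auto simp: I_def)
  qed
  let ?p = "\<lambda>B k. (r * measure lborel B) ^ k / fact k * exp (- (r * measure lborel B))"
  have joint: "prob {\<omega>\<in>space M. \<forall>j<m. point_count X (B j) \<omega> = k j} = (\<Prod>j<m. ?p (B j) (k j))"
    if B: "\<And>j. j < m \<Longrightarrow> B j \<in> sets borel \<and> bounded (B j)" and disj: "disjoint_family_on B {..<m}"
    for m :: nat and B :: "nat \<Rightarrow> real set" and k :: "nat \<Rightarrow> nat"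
  proof (rule joint_law_from_generating_function
      [where p = "\<lambda>j. ?p (B j)" and N = "\<lambda>j. point_count X (B j)"
        and P = "\<lambda>j x. exp (- r * ((1 - x) * measure lborel (B j)))"])
    show "point_count X (B j) \<in> measurable M (count_space UNIV)" if "j < m" for j
      using B[OF that] by (intro measurable_point_count) auto
    show "(\<lambda>k. ?p (B j) k * x ^ k) sums exp (- r * ((1 - x) * measure lborel (B j)))" for j x
      using sums_mult2[OF exp_converges[of "r * measure lborel (B j) * x"], of "exp (- (r * measure lborel (B j)))"]
      by (simp add: field_simps power_mult_distrib exp_add[symmetric])
    show "expectation (\<lambda>\<omega>. \<Prod>j<m. z j ^ point_count X (B j) \<omega>)
       = (\<Prod>j<m. exp (- r * ((1 - z j) * measure lborel (B j))))"
      if z: "\<forall>j<m. 0 \<le> z j \<and> z j \<le> 1" for z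
    proof -
      have "expectation (\<lambda>\<omega>. \<Prod>j<m. z j ^ point_count X (B j) \<omega>)
        = exp (- r * (\<integral>x. 1 - step_function m z B x \<partial>lborel))"
        using z B disj fin
        by (intro LIMSEQ_unique[OF window_products_tendsto_generating_function lim]) auto
      also have "\<dots> = (\<Prod>j<m. exp (- r * ((1 - z j) * measure lborel (B j))))"
        by (subst integral_one_minus_step_function(2)[OF B disj, of z])
          (simp_all add: exp_sum sum_distrib_left sum_negf [symmetric])
      finally show ?thesis .
    qed
  qed
  have single: "prob {\<omega>\<in>space M. point_count X B \<omega> = k} = ?p B k" if "B \<in> sets borel" "bounded B" for B k
    using joint[of 1 "\<lambda>_. B" "\<lambda>_. k"] that by (simp add: disjoint_family_on_def)
  have indep: "indep_vars (\<lambda>_. count_space UNIV) (\<lambda>j. point_count X (B j)) {..<m}"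
    if B: "\<And>j. j < m \<Longrightarrow> B j \<in> sets borel \<and> bounded (B j)" and disj: "disjoint_family_on B {..<m}"
    for m :: nat and B :: "nat \<Rightarrow> real set"
  proof (cases "m = 0")
    case True
    then show ?thesis by (simp add: indep_vars_def indep_sets_def)
  next
    case False
    define E where "E = insert {} (insert UNIV (range (\<lambda>k::nat. {k})))"
    have meas: "point_count X (B j) \<in> measurable M (count_space UNIV)" if "j < m" for j
      using B[OF that] by (intro measurable_point_count) auto
    have gen: "sets (count_space (UNIV :: nat set)) = sigma_sets UNIV E"
    proof -
      have "A \<in> sigma_sets UNIV E" for A
      proof -
        have "(\<Union>k\<in>A. {k}) \<in> sigma_sets UNIV E"
          by (rule sigma_sets_UNION) (auto simp: E_def intro: countable_image)
        then show ?thesis by simp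
      qed
      then show ?thesis by auto
    qed
    have prod: "prob (\<Inter>j<m. point_count X (B j) -` A j \<inter> space M)
        = (\<Prod>j<m. prob (point_count X (B j) -` A j \<inter> space M))" if A: "A \<in> {..<m} \<rightarrow> E" for A
    proof (cases "\<exists>j<m. A j = {}")
      case True
      then obtain i where i: "i < m" "A i = {}" by auto
      then have "(\<Inter>j<m. point_count X (B j) -` A j \<inter> space M) = {}" by auto
      moreover have "(\<Prod>j<m. prob (point_count X (B j) -` A j \<inter> space M)) = 0"
        using i by (intro prod_zero bexI[of _ i]) auto
      ultimately show ?thesis by simp
    next
      case False
      \<comment> \<open>A coordinate with the condition \<open>UNIV\<close> is replaced by the count of the empty set,
        which is \<open>0\<close>; this avoids summing over that coordinate.\<close>
      define B' where "B' j = (if A j = UNIV then {} else B j)" for j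
      define k where "k j = (if A j = UNIV then 0 else the_elem (A j))" for j
      have eq: "point_count X (B j) -` A j \<inter> space M = {\<omega>\<in>space M. point_count X (B' j) \<omega> = k j}"
        if j: "j < m" for j
      proof -
        have "A j \<in> E" using A j by auto
        then consider "A j = UNIV" | i where "A j = {i}" "A j \<noteq> UNIV"
          using False j by (auto simp: E_def)
        then show ?thesis
        proof cases
          case 1
          then have "B' j = {}" "k j = 0" by (simp_all add: B'_def k_def)
          then show ?thesis by (simp add: 1 point_count_def)
        next
          case 2
          then have "B' j = B j" "k j = i" by (simp_all add: B'_def k_def)
          then show ?thesis by (auto simp: 2(1))
        qed
      qed
      have B': "B' j \<in> sets borel \<and> bounded (B' j)" if "j < m" for j
        using B[OF that] by (auto simp: B'_def)
      have disj': "disjoint_family_on B' {..<m}"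
        using disj by (auto simp: disjoint_family_on_def B'_def)
      have "(\<Inter>j<m. point_count X (B j) -` A j \<inter> space M)
          = {\<omega>\<in>space M. \<forall>j<m. point_count X (B' j) \<omega> = k j}"
        using \<open>m \<noteq> 0\<close> by (subst INF_cong[OF refl eq]) auto
      moreover have "(\<Prod>j<m. prob (point_count X (B j) -` A j \<inter> space M)) = (\<Prod>j<m. ?p (B' j) (k j))"
        using B' by (intro prod.cong refl) (simp add: eq single)
      ultimately show ?thesis
        using joint[OF B' disj', of k] by simp
    qed
    show ?thesis
    proof (subst indep_vars_finite[where E="\<lambda>_. E"])
      show "{..<m} \<noteq> {}" using False by auto
      show "Int_stable E" by (auto simp: E_def Int_stable_def)
      show "\<forall>A\<in>{..<m} \<rightarrow> E. prob (\<Inter>j\<in>{..<m}. point_count X (B j) -` A j \<inter> space M)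
        = (\<Prod>j\<in>{..<m}. prob (point_count X (B j) -` A j \<inter> space M))"
        using prod by blast
    qed (use meas gen in \<open>simp_all add: E_def\<close>)
  qed
  show ?thesis
    unfolding poisson_process_def using r fin single indep by auto
qed

end

text \<open>
  Used to interchange the limit over the windows with the limit of approximating functions;
  both limits are monotone.
\<close>

lemma decreasing_double_limit:
  fixes a :: "nat \<Rightarrow> nat \<Rightarrow> real"
  assumes row: "\<And>n. (\<lambda>k. a n k) \<longlonglongrightarrow> \<alpha> n" and col: "\<And>k. (\<lambda>n. a n k) \<longlonglongrightarrow> b k"
    and b: "b \<longlonglongrightarrow> \<beta>"
    and decn: "\<And>k. decseq (\<lambda>n. a n k)" and deck: "\<And>n. decseq (\<lambda>k. a n k)"
  shows "\<alpha> \<longlonglongrightarrow> \<beta>"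
proof (rule order_tendstoI)
  have 1: "\<alpha> n \<le> a n k" for n k
    by (rule decseq_ge[OF deck row])
  have 2: "b k \<le> a n k" for n k
    by (rule decseq_ge[OF decn col])
  have "decseq b"
    unfolding decseq_def using decseqD[OF deck] by (auto intro!: LIMSEQ_le[OF col col])
  then have 3: "\<beta> \<le> b k" for k
    using b by (rule decseq_ge)
  have 4: "\<beta> \<le> \<alpha> n" for n
    by (rule LIMSEQ_le_const[OF row]) (meson 2 3 order_trans)
  show "\<forall>\<^sub>F n in sequentially. y < \<alpha> n" if "y < \<beta>" for y
    using 4 that by (intro always_eventually allI) (rule less_le_trans)
  show "\<forall>\<^sub>F n in sequentially. \<alpha> n < y" if y: "\<beta> < y" for y
  proof -
    obtain k where "b k < y"
      using order_tendstoD(2)[OF b y] by (auto simp: eventually_sequentially)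
    from order_tendstoD(2)[OF col this] show ?thesis
      by eventually_elim (rule le_less_trans[OF 1])
  qed
qed

text \<open>
  Rounding \<open>1 - f\<close> down to a multiple of \<open>1 / 2 ^ k\<close> and cutting it off outside
  \<open>[-k, k]\<close> gives step functions with bounded level sets that decrease to \<open>f\<close>.
\<close>

definition dyadic_approx :: "(real \<Rightarrow> real) \<Rightarrow> nat \<Rightarrow> real \<Rightarrow> real" where
  "dyadic_approx f k x = (if \<bar>x\<bar> \<le> real k then 1 - real_of_int \<lfloor>2 ^ k * (1 - f x)\<rfloor> / 2 ^ k else 1)"

lemma dyadic_floor_mono:
  fixes u :: real
  shows "real_of_int \<lfloor>2 ^ k * u\<rfloor> / 2 ^ k \<le> real_of_int \<lfloor>2 ^ Suc k * u\<rfloor> / 2 ^ Suc k"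
proof -
  have "2 * \<lfloor>2 ^ k * u\<rfloor> \<le> \<lfloor>2 * (2 ^ k * u)\<rfloor>"
    by (simp add: le_floor_iff)
  then have "2 * real_of_int \<lfloor>2 ^ k * u\<rfloor> \<le> real_of_int \<lfloor>2 * (2 ^ k * u)\<rfloor>"
    by linarith
  then show ?thesis
    by (simp add: field_simps)
qed

lemma dyadic_approx_bounds:
  assumes "0 \<le> f x" "f x \<le> 1"
  shows "f x \<le> dyadic_approx f k x" "dyadic_approx f k x \<le> 1"
proof -
  have "real_of_int \<lfloor>2 ^ k * (1 - f x)\<rfloor> / 2 ^ k \<le> 1 - f x"
    using of_int_floor_le[of "2 ^ k * (1 - f x)"] by (simp add: pos_divide_le_eq mult.commute)
  then show "f x \<le> dyadic_approx f k x"
    using assms by (simp add: dyadic_approx_def)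
  show "dyadic_approx f k x \<le> 1"
    using assms by (simp add: dyadic_approx_def)
qed

lemma decseq_dyadic_approx:
  assumes "0 \<le> f x" "f x \<le> 1"
  shows "decseq (\<lambda>k. dyadic_approx f k x)"
proof (rule decseq_SucI)
  show "dyadic_approx f (Suc k) x \<le> dyadic_approx f k x" for k
    using dyadic_floor_mono[of k "1 - f x"] dyadic_approx_bounds(2)[where k="Suc k", of f x] assms
    by (auto simp: dyadic_approx_def)
qed

lemma dyadic_approx_tendsto:
  "(\<lambda>k. dyadic_approx f k x) \<longlonglongrightarrow> f x"
proof -
  define u where "u = 1 - f x"
  have bound: "\<bar>real_of_int \<lfloor>2 ^ k * u\<rfloor> / 2 ^ k - u\<bar> \<le> (1 / 2) ^ k" for k
  proof -
    have "\<bar>real_of_int \<lfloor>2 ^ k * u\<rfloor> - 2 ^ k * u\<bar> \<le> 1" by linarith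
    then have "\<bar>real_of_int \<lfloor>2 ^ k * u\<rfloor> - 2 ^ k * u\<bar> / 2 ^ k \<le> 1 / 2 ^ k"
      by (intro divide_right_mono) auto
    moreover have "\<bar>real_of_int \<lfloor>2 ^ k * u\<rfloor> - 2 ^ k * u\<bar> / 2 ^ k = \<bar>real_of_int \<lfloor>2 ^ k * u\<rfloor> / 2 ^ k - u\<bar>"
      by (simp add: field_simps abs_divide [symmetric] del: abs_divide)
    ultimately show ?thesis by (simp add: power_divide)
  qed
  have "(\<lambda>k. real_of_int \<lfloor>2 ^ k * u\<rfloor> / 2 ^ k - u) \<longlonglongrightarrow> 0"
    by (rule Lim_null_comparison[OF _ LIMSEQ_power_zero[of "1/2::real"]])
       (use bound in \<open>auto intro!: always_eventually\<close>)
  then have "(\<lambda>k. 1 - (real_of_int \<lfloor>2 ^ k * u\<rfloor> / 2 ^ k - u) - u) \<longlonglongrightarrow> 1 - 0 - u"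
    by (intro tendsto_intros)
  moreover have "\<forall>\<^sub>F k in sequentially. 1 - (real_of_int \<lfloor>2 ^ k * u\<rfloor> / 2 ^ k - u) - u = dyadic_approx f k x"
  proof (rule eventually_sequentiallyI)
    fix k assume "nat \<lceil>\<bar>x\<bar>\<rceil> \<le> k"
    then show "1 - (real_of_int \<lfloor>2 ^ k * u\<rfloor> / 2 ^ k - u) - u = dyadic_approx f k x"
      by (simp add: dyadic_approx_def u_def)
  qed
  ultimately show ?thesis
    using Lim_transform_eventually by (fastforce simp: u_def)
qed

lemma dyadic_approx_eq_step_function:
  assumes f: "\<And>x. 0 \<le> f x" "\<And>x. f x \<le> 1"
  shows "dyadic_approx f k = step_function (2 ^ k + 1) (\<lambda>j. 1 - real j / 2 ^ k)
           (\<lambda>j. {x. \<bar>x\<bar> \<le> real k \<and> \<lfloor>2 ^ k * (1 - f x)\<rfloor> = int j})"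
proof
  fix x
  define l where "l = nat \<lfloor>2 ^ k * (1 - f x)\<rfloor>"
  have l: "int l = \<lfloor>2 ^ k * (1 - f x)\<rfloor>"
    using f[of x] by (simp add: l_def)
  have "\<lfloor>2 ^ k * (1 - f x)\<rfloor> \<le> 2 ^ k"
    using f(1)[of x] floor_mono[of "2 ^ k * (1 - f x)" "2 ^ k"] by (simp add: mult_left_le)
  then have "int l \<le> int (2 ^ k)"
    by (simp add: l)
  then have "l < 2 ^ k + 1"
    by (simp only: of_nat_le_iff less_Suc_eq_le Suc_eq_plus1 [symmetric])
  have "step_function (2 ^ k + 1) (\<lambda>j. 1 - real j / 2 ^ k)
           (\<lambda>j. {x. \<bar>x\<bar> \<le> real k \<and> \<lfloor>2 ^ k * (1 - f x)\<rfloor> = int j}) x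
      = (\<Prod>j<2 ^ k + 1. if j = l then (if \<bar>x\<bar> \<le> real k then 1 - real l / 2 ^ k else 1) else 1)"
    unfolding step_function_def by (intro prod.cong) (auto simp: l[symmetric])
  also have "\<dots> = dyadic_approx f k x"
    using \<open>l < 2 ^ k + 1\<close> by (simp add: prod.delta dyadic_approx_def l[symmetric] del: prod.lessThan_Suc)
  finally show "dyadic_approx f k x = step_function (2 ^ k + 1) (\<lambda>j. 1 - real j / 2 ^ k)
           (\<lambda>j. {x. \<bar>x\<bar> \<le> real k \<and> \<lfloor>2 ^ k * (1 - f x)\<rfloor> = int j}) x" ..
qed

context prob_space
begin

theorem poisson_process_functional:
  fixes X :: "int \<Rightarrow> 'a \<Rightarrow> real"
  assumes X: "poisson_process r X" and [measurable]: "\<And>i. X i \<in> borel_measurable M"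
    and f_meas [measurable]: "f \<in> borel_measurable borel" and f: "\<And>x. 0 \<le> f x" "\<And>x. f x \<le> 1"
    and int: "integrable lborel (\<lambda>x. 1 - f x)"
  shows "(\<lambda>n. expectation (\<lambda>\<omega>. \<Prod>i\<in>window n. f (X i \<omega>))) \<longlonglongrightarrow> exp (- r * (\<integral>x. 1 - f x \<partial>lborel))"
proof (rule decreasing_double_limit)
  let ?g = "dyadic_approx f"
  have [measurable]: "?g k \<in> borel_measurable borel" for k
    unfolding dyadic_approx_def [abs_def] by measurable
  have g: "0 \<le> ?g k x" "?g k x \<le> 1" for k x
    using dyadic_approx_bounds[of f x k] f[of x] by auto
  have g_int: "integrable M (\<lambda>\<omega>. \<Prod>i\<in>window n. ?g k (X i \<omega>))" for n k
    using g by (intro integrable_const_bound[where B=1]) (auto simp: abs_prod intro!: prod_le_1)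
  show "(\<lambda>k. expectation (\<lambda>\<omega>. \<Prod>i\<in>window n. ?g k (X i \<omega>)))
     \<longlonglongrightarrow> expectation (\<lambda>\<omega>. \<Prod>i\<in>window n. f (X i \<omega>))" for n
    by (rule integral_dominated_convergence[where w="\<lambda>_. 1"])
       (use g in \<open>auto simp: abs_prod intro!: prod_le_1 tendsto_prod dyadic_approx_tendsto\<close>)
  show "(\<lambda>n. expectation (\<lambda>\<omega>. \<Prod>i\<in>window n. ?g k (X i \<omega>)))
     \<longlonglongrightarrow> exp (- r * (\<integral>x. 1 - ?g k x \<partial>lborel))" for k
    unfolding dyadic_approx_eq_step_function[OF f]
  proof (rule poisson_process_step_functional[OF X])
    fix j :: nat assume j: "j < 2 ^ k + 1"
    have "bounded {x. \<bar>x\<bar> \<le> real k \<and> \<lfloor>2 ^ k * (1 - f x)\<rfloor> = int j}"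
      by (rule bounded_subset[of "{- real k..real k}"]) auto
    moreover have "{x. \<bar>x\<bar> \<le> real k \<and> \<lfloor>2 ^ k * (1 - f x)\<rfloor> = int j} \<in> sets borel"
      by measurable
    ultimately show "{x. \<bar>x\<bar> \<le> real k \<and> \<lfloor>2 ^ k * (1 - f x)\<rfloor> = int j} \<in> sets borel \<and>
        bounded {x. \<bar>x\<bar> \<le> real k \<and> \<lfloor>2 ^ k * (1 - f x)\<rfloor> = int j}" by simp
    have "real j \<le> real (2 ^ k)" using j by (intro of_nat_mono) simp
    then show "0 \<le> 1 - real j / 2 ^ k \<and> 1 - real j / 2 ^ k \<le> 1"
      by (simp add: field_simps)
  qed (auto simp: disjoint_family_on_def)
  have "(\<lambda>k. \<integral>x. 1 - ?g k x \<partial>lborel) \<longlonglongrightarrow> (\<integral>x. 1 - f x \<partial>lborel)"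
  proof (rule integral_dominated_convergence[OF _ _ int])
    show "AE x in lborel. norm (1 - ?g k x) \<le> 1 - f x" for k
      using g dyadic_approx_bounds(1)[where f = f and k = k, OF f] by (intro AE_I2) simp
  qed (auto intro!: tendsto_intros dyadic_approx_tendsto)
  then show "(\<lambda>k. exp (- r * (\<integral>x. 1 - ?g k x \<partial>lborel))) \<longlonglongrightarrow> exp (- r * (\<integral>x. 1 - f x \<partial>lborel))"
    by (intro tendsto_intros)
  show "decseq (\<lambda>n. expectation (\<lambda>\<omega>. \<Prod>i\<in>window n. ?g k (X i \<omega>)))" for k
    unfolding decseq_def
  proof (intro allI impI integral_mono g_int)
    fix m n \<omega> assume "m \<le> (n::nat)"
    have "(\<Prod>i\<in>window n. ?g k (X i \<omega>))
        = (\<Prod>i\<in>window n - window m. ?g k (X i \<omega>)) * (\<Prod>i\<in>window m. ?g k (X i \<omega>))"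
      using window_mono[OF \<open>m \<le> n\<close>] by (intro prod.subset_diff) auto
    also have "\<dots> \<le> 1 * (\<Prod>i\<in>window m. ?g k (X i \<omega>))"
      using g by (intro mult_right_mono prod_le_1 prod_nonneg) auto
    finally show "(\<Prod>i\<in>window n. ?g k (X i \<omega>)) \<le> (\<Prod>i\<in>window m. ?g k (X i \<omega>))" by simp
  qed
  show "decseq (\<lambda>k. expectation (\<lambda>\<omega>. \<Prod>i\<in>window n. ?g k (X i \<omega>)))" for n
    unfolding decseq_def
    using g decseqD[OF decseq_dyadic_approx[where f=f]] f
    by (intro allI impI integral_mono g_int prod_mono) auto
qed

end

section \<open>Independent marks and displacement\<close>

context prob_space
begin

text \<open>
  Conditionally on the points, the factors are independent, and a mark at \<open>T i\<close>
  contributes its mean \<open>\<integral>y. \<phi> (T i) y\<close>.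
\<close>

lemma expectation_prod_independent_marks:
  fixes T Y :: "int \<Rightarrow> 'a \<Rightarrow> real" and \<phi> :: "real \<Rightarrow> real \<Rightarrow> real"
  assumes indep: "indep_var (\<Pi>\<^sub>M i\<in>UNIV. borel) (\<lambda>\<omega> i. T i \<omega>) (\<Pi>\<^sub>M i\<in>UNIV. borel) (\<lambda>\<omega> i. Y i \<omega>)"
    and Y: "iid Y D"
    and \<phi>_meas [measurable]: "case_prod \<phi> \<in> borel_measurable (borel \<Otimes>\<^sub>M borel)"
    and \<phi>: "\<And>x y. 0 \<le> \<phi> x y" "\<And>x y. \<phi> x y \<le> 1" and J: "finite J"
  shows "expectation (\<lambda>\<omega>. \<Prod>i\<in>J. \<phi> (T i \<omega>) (Y i \<omega>)) = expectation (\<lambda>\<omega>. \<Prod>i\<in>J. \<integral>y. \<phi> (T i \<omega>) y \<partial>D)"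
proof -
  let ?P = "\<Pi>\<^sub>M i\<in>(UNIV :: int set). (borel :: real measure)"
  let ?T = "\<lambda>\<omega> i. T i \<omega>" and ?Y = "\<lambda>\<omega> i. Y i \<omega>"
  have [measurable]: "?T \<in> measurable M ?P" "?Y \<in> measurable M ?P"
    using indep by (auto simp: indep_var_distribution_eq)
  have joint: "distr M ?P ?T \<Otimes>\<^sub>M distr M ?P ?Y = distr M (?P \<Otimes>\<^sub>M ?P) (\<lambda>\<omega>. (?T \<omega>, ?Y \<omega>))"
    using indep by (auto simp: indep_var_distribution_eq)
  have ind: "indep_vars (\<lambda>_. borel) Y UNIV" and D: "\<And>i. distr M borel (Y i) = D"
    using Y by (auto simp: iid_def)
  have Y_meas [measurable]: "Y i \<in> borel_measurable M" for i
    using ind by (auto simp: indep_vars_def)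
  have sets_D [measurable_cong]: "sets D = sets borel"
    using D[of 0] by auto
  interpret D: prob_space D
    using prob_space_distr[OF Y_meas[of 0]] D by simp
  interpret PT: prob_space "distr M ?P ?T" by (rule prob_space_distr) measurable
  interpret PY: prob_space "distr M ?P ?Y" by (rule prob_space_distr) measurable
  interpret PP: pair_prob_space "distr M ?P ?T" "distr M ?P ?Y" ..
  define h where "h = (\<lambda>(t :: int \<Rightarrow> real, y :: int \<Rightarrow> real). \<Prod>i\<in>J. \<phi> (t i) (y i))"
  have [measurable]: "h \<in> borel_measurable (?P \<Otimes>\<^sub>M ?P)"
    unfolding h_def by measurable
  have h_int: "integrable (distr M ?P ?T \<Otimes>\<^sub>M distr M ?P ?Y) h"
    by (rule PP.P.integrable_const_bound[where B=1])
       (use \<phi> in \<open>auto simp: h_def abs_prod split: prod.split intro!: prod_le_1\<close>)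
  have inner: "expectation (\<lambda>\<omega>. \<Prod>i\<in>J. \<phi> (t i) (Y i \<omega>)) = (\<Prod>i\<in>J. \<integral>y. \<phi> (t i) y \<partial>D)" for t
  proof (cases "J = {}")
    case False
    have "indep_vars (\<lambda>_. borel) (\<lambda>i \<omega>. \<phi> (t i) (Y i \<omega>)) J"
      by (rule indep_vars_compose2[OF indep_vars_subset[OF ind]]) auto
    then have "expectation (\<lambda>\<omega>. \<Prod>i\<in>J. \<phi> (t i) (Y i \<omega>)) = (\<Prod>i\<in>J. expectation (\<lambda>\<omega>. \<phi> (t i) (Y i \<omega>)))"
      by (rule indep_vars_lebesgue_integral[OF J])
         (auto intro!: integrable_const_bound[where B=1] simp: \<phi>)
    also have "\<dots> = (\<Prod>i\<in>J. \<integral>y. \<phi> (t i) y \<partial>D)"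
      by (intro prod.cong refl) (subst D[symmetric], subst integral_distr, auto)
    finally show ?thesis .
  qed (simp add: prob_space)
  have "expectation (\<lambda>\<omega>. \<Prod>i\<in>J. \<phi> (T i \<omega>) (Y i \<omega>)) = (\<integral>p. h p \<partial>distr M (?P \<Otimes>\<^sub>M ?P) (\<lambda>\<omega>. (?T \<omega>, ?Y \<omega>)))"
    by (subst integral_distr) (auto simp: h_def)
  also have "\<dots> = (\<integral>t. \<integral>y. h (t, y) \<partial>distr M ?P ?Y \<partial>distr M ?P ?T)"
    unfolding joint[symmetric] by (rule PP.integral_fst'[OF h_int, symmetric])
  also have "\<dots> = (\<integral>t. (\<Prod>i\<in>J. \<integral>y. \<phi> (t i) y \<partial>D) \<partial>distr M ?P ?T)"
    by (intro Bochner_Integration.integral_cong refl, subst integral_distr)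
       (auto simp: h_def inner)
  also have "\<dots> = expectation (\<lambda>\<omega>. \<Prod>i\<in>J. \<integral>y. \<phi> (T i \<omega>) y \<partial>D)"
    by (subst integral_distr) (auto intro!: borel_measurable_prod)
  finally show ?thesis .
qed

text \<open>
  Averaging over the marks leaves a product of a function of the points alone, to which the
  product functional of the Poisson process applies. With \<open>\<phi> x y = f (x + y)\<close> this
  describes the displaced points, and with \<open>\<phi>\<close> the indicator that both \<open>x\<close>
  and \<open>x + y\<close> avoid a set it describes the void probabilities of the superposition.
\<close>

lemma marked_poisson_functional:
  fixes T Y :: "int \<Rightarrow> 'a \<Rightarrow> real" and \<phi> :: "real \<Rightarrow> real \<Rightarrow> real"
  assumes T: "poisson_process r T"
    and indep: "indep_var (\<Pi>\<^sub>M i\<in>UNIV. borel) (\<lambda>\<omega> i. T i \<omega>) (\<Pi>\<^sub>M i\<in>UNIV. borel) (\<lambda>\<omega> i. Y i \<omega>)"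
    and Y: "iid Y D"
    and \<phi>_meas [measurable]: "case_prod \<phi> \<in> borel_measurable (borel \<Otimes>\<^sub>M borel)"
    and \<phi>: "\<And>x y. 0 \<le> \<phi> x y" "\<And>x y. \<phi> x y \<le> 1"
    and int: "integrable lborel (\<lambda>x. \<integral>y. 1 - \<phi> x y \<partial>D)"
  shows "(\<lambda>n. expectation (\<lambda>\<omega>. \<Prod>i\<in>window n. \<phi> (T i \<omega>) (Y i \<omega>)))
           \<longlonglongrightarrow> exp (- r * (\<integral>x. \<integral>y. 1 - \<phi> x y \<partial>D \<partial>lborel))"
proof -
  have T_meas: "T i \<in> borel_measurable M" for i
  proof -
    have "(\<lambda>\<omega> i. T i \<omega>) \<in> measurable M (\<Pi>\<^sub>M i\<in>UNIV. borel)"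
      using indep by (auto simp: indep_var_distribution_eq)
    then show ?thesis by measurable
  qed
  have D: "\<And>i. distr M borel (Y i) = D" and Y_meas: "\<And>i. Y i \<in> borel_measurable M"
    using Y by (auto simp: iid_def indep_vars_def)
  have sets_D [measurable_cong]: "sets D = sets borel"
    using D[of 0] by auto
  interpret D: prob_space D
    using prob_space_distr[OF Y_meas[of 0]] D by simp
  let ?g = "\<lambda>x. \<integral>y. \<phi> x y \<partial>D"
  have int_\<phi>: "integrable D (\<phi> x)" for x
    by (rule D.integrable_const_bound[where B=1]) (auto simp: \<phi>)
  have one_minus: "1 - ?g x = (\<integral>y. 1 - \<phi> x y \<partial>D)" for x
    using int_\<phi> by (simp add: D.prob_space)
  have g: "0 \<le> ?g x" "?g x \<le> 1" for x
    using \<phi> int_\<phi> by (auto intro!: D.integral_le_const)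
  have "(\<lambda>n. expectation (\<lambda>\<omega>. \<Prod>i\<in>window n. ?g (T i \<omega>))) \<longlonglongrightarrow> exp (- r * (\<integral>x. 1 - ?g x \<partial>lborel))"
    by (rule poisson_process_functional[OF T T_meas]) (use int g in \<open>auto simp: one_minus\<close>)
  then show ?thesis
    by (simp add: expectation_prod_independent_marks[OF indep Y \<phi>_meas \<phi>] one_minus)
qed

end

text \<open>
  Lebesgue measure is invariant under each single shift, hence also under a random one.
\<close>

lemma translation_average_integral:
  fixes D :: "real measure" and u :: "real \<Rightarrow> real"
  assumes "prob_space D" and [measurable_cong]: "sets D = sets borel"
    and u: "integrable lborel u"
  shows "integrable lborel (\<lambda>x. \<integral>y. u (x + y) \<partial>D)"
    and "(\<integral>x. \<integral>y. u (x + y) \<partial>D \<partial>lborel) = (\<integral>x. u x \<partial>lborel)"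
proof -
  interpret D: prob_space D by fact
  interpret pair_sigma_finite D lborel ..
  have [measurable]: "u \<in> borel_measurable borel" using u by auto
  have shift: "integrable lborel (\<lambda>x. u (x + y))" "(\<integral>x. u (x + y) \<partial>lborel) = (\<integral>x. u x \<partial>lborel)"
     "(\<integral>x. norm (u (x + y)) \<partial>lborel) = (\<integral>x. norm (u x) \<partial>lborel)" for y
    using lborel_integrable_real_affine[OF u, of 1 y] lborel_integral_real_affine[of 1 u y]
      lborel_integral_real_affine[of 1 "\<lambda>x. norm (u x)" y]
    by (simp_all add: add.commute)
  have int: "integrable (D \<Otimes>\<^sub>M lborel) (\<lambda>(y, x). u (x + y))"
    by (rule Fubini_integrable) (use shift in auto)
  show "integrable lborel (\<lambda>x. \<integral>y. u (x + y) \<partial>D)"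
    using integrable_snd[OF int] by simp
  show "(\<integral>x. \<integral>y. u (x + y) \<partial>D \<partial>lborel) = (\<integral>x. u x \<partial>lborel)"
    using Fubini_integral[OF int] shift(2) by (simp add: D.prob_space)
qed

context prob_space
begin

text \<open>
  The displacement theorem: shifting the points independently changes the function
  \<open>f\<close> in the product functional to its average over shifts, which has the same integral of
  \<open>1 - f\<close>.
\<close>

theorem displaced_poisson_process:
  fixes T Y :: "int \<Rightarrow> 'a \<Rightarrow> real"
  assumes T: "poisson_process r T"
    and indep: "indep_var (\<Pi>\<^sub>M i\<in>UNIV. borel) (\<lambda>\<omega> i. T i \<omega>) (\<Pi>\<^sub>M i\<in>UNIV. borel) (\<lambda>\<omega> i. Y i \<omega>)"
    and Y: "iid Y D"
  shows "poisson_process r (\<lambda>i \<omega>. T i \<omega> + Y i \<omega>)"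
proof (rule poisson_processI)
  show "0 < r" using T by (rule poisson_processD)
  have vec: "(\<lambda>\<omega> i. T i \<omega>) \<in> measurable M (\<Pi>\<^sub>M i\<in>UNIV. borel)"
    using indep by (auto simp: indep_var_distribution_eq)
  have D: "\<And>i. distr M borel (Y i) = D" and Y_meas [measurable]: "\<And>i. Y i \<in> borel_measurable M"
    using Y by (auto simp: iid_def indep_vars_def)
  have [measurable]: "T i \<in> borel_measurable M" for i
    using vec by measurable
  show "(\<lambda>\<omega>. T i \<omega> + Y i \<omega>) \<in> borel_measurable M" for i
    by measurable
  have sets_D: "sets D = sets borel"
    using D[of 0] by auto
  have prob_D: "prob_space D"
    using prob_space_distr[OF Y_meas[of 0]] D by simp
  fix m :: nat and c :: "nat \<Rightarrow> real" and B :: "nat \<Rightarrow> real set"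
  assume B: "\<And>j. j < m \<Longrightarrow> B j \<in> sets borel \<and> bounded (B j)"
    and disj: "disjoint_family_on B {..<m}" and c: "\<And>j. j < m \<Longrightarrow> 0 \<le> c j \<and> c j \<le> 1"
  let ?f = "step_function m c B"
  note avg = translation_average_integral[OF prob_D sets_D integral_one_minus_step_function(1)[OF B disj, of c]]
  have [measurable]: "?f \<in> borel_measurable borel"
    using B by (intro step_function_measurable) auto
  have "(\<lambda>n. expectation (\<lambda>\<omega>. \<Prod>i\<in>window n. ?f (T i \<omega> + Y i \<omega>)))
           \<longlonglongrightarrow> exp (- r * (\<integral>x. \<integral>y. 1 - ?f (x + y) \<partial>D \<partial>lborel))"
    by (rule marked_poisson_functional[OF T indep Y])
       (use avg(1) step_function_bounds[OF c] in auto)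
  then show "(\<lambda>n. expectation (\<lambda>\<omega>. \<Prod>i\<in>window n. ?f (T i \<omega> + Y i \<omega>)))
           \<longlonglongrightarrow> exp (- r * (\<integral>x. 1 - ?f x \<partial>lborel))"
    by (simp only: avg(2))
qed

end

section \<open>Void probabilities of a Poisson process with delayed copies\<close>

context prob_space
begin

text \<open>
  A point at \<open>x\<close> with delay \<open>y\<close> hits \<open>B\<close> by itself or through its
  delayed copy. By inclusion and exclusion, the probability of a hit, integrated over \<open>x\<close>,
  is \<open>2 * \<bar>B\<bar>\<close> minus the mean overlap of \<open>B\<close> with its shift.
\<close>

lemma void_probability:
  fixes T Y :: "int \<Rightarrow> 'a \<Rightarrow> real"
  assumes T: "poisson_process r T"
    and indep: "indep_var (\<Pi>\<^sub>M i\<in>UNIV. borel) (\<lambda>\<omega> i. T i \<omega>) (\<Pi>\<^sub>M i\<in>UNIV. borel) (\<lambda>\<omega> i. Y i \<omega>)"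
    and Y: "iid Y D"
    and B: "B \<in> sets borel" "bounded B"
  shows "prob {\<omega>\<in>space M. \<forall>i. T i \<omega> \<notin> B \<and> T i \<omega> + Y i \<omega> \<notin> B}
    = exp (- r * (2 * measure lborel B - (\<integral>y. \<integral>x. indicator B x * indicator B (x + y) \<partial>lborel \<partial>D)))"
proof -
  note [measurable] = B(1)
  have vec: "(\<lambda>\<omega> i. T i \<omega>) \<in> measurable M (\<Pi>\<^sub>M i\<in>UNIV. borel)"
    using indep by (auto simp: indep_var_distribution_eq)
  have D: "\<And>i. distr M borel (Y i) = D" and Y_meas [measurable]: "\<And>i. Y i \<in> borel_measurable M"
    using Y by (auto simp: iid_def indep_vars_def)
  have [measurable]: "T i \<in> borel_measurable M" for i
    using vec by measurable
  have sets_D [measurable_cong]: "sets D = sets borel"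
    using D[of 0] by auto
  interpret D: prob_space D
    using prob_space_distr[OF Y_meas[of 0]] D by simp
  interpret Q: pair_sigma_finite D lborel ..
  define b :: "real \<Rightarrow> real" where "b = indicator B"
  have [measurable]: "b \<in> borel_measurable borel" by (simp add: b_def)
  have b01: "0 \<le> b x" "b x \<le> 1" for x by (auto simp: b_def indicator_def)
  define \<phi> where "\<phi> x y = (1 - b x) * (1 - b (x + y))" for x y
  have \<phi>01: "0 \<le> \<phi> x y" "\<phi> x y \<le> 1" for x y
    using b01 by (auto simp: \<phi>_def intro: mult_le_one)
  have \<phi>_meas [measurable]: "case_prod \<phi> \<in> borel_measurable (borel \<Otimes>\<^sub>M borel)"
    unfolding \<phi>_def by measurable
  have int_b: "integrable lborel b"
    unfolding b_def using B emeasure_bounded_finite[OF B(2)] by (intro integrable_real_indicator) auto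
  have integral_b: "(\<integral>x. b x \<partial>lborel) = measure lborel B"
    by (simp add: b_def)
  note avg = translation_average_integral[OF D.prob_space_axioms sets_D int_b]
  have int_shift: "integrable D (\<lambda>y. b (x + y))" for x
    using b01 by (intro D.integrable_const_bound[where B=1]) auto
  have int_pair: "integrable (D \<Otimes>\<^sub>M lborel) (\<lambda>(y, x). b x * b (x + y))"
  proof (rule Bochner_Integration.integrable_bound)
    show "integrable (D \<Otimes>\<^sub>M lborel) (\<lambda>(y, x). b x)"
      by (rule Q.Fubini_integrable) (use int_b in auto)
    show "AE p in D \<Otimes>\<^sub>M lborel. norm (case p of (y, x) \<Rightarrow> b x * b (x + y)) \<le> norm (case p of (y, x) \<Rightarrow> b x)"
      using b01 by (intro AE_I2) (auto split: prod.split simp: abs_mult intro!: mult_left_le)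
  qed measurable
  have int_bb: "integrable lborel (\<lambda>x. \<integral>y. b x * b (x + y) \<partial>D)"
    using Q.integrable_snd[OF int_pair] .
  have one_minus: "(\<integral>y. 1 - \<phi> x y \<partial>D) = b x + (\<integral>y. b (x + y) \<partial>D) - (\<integral>y. b x * b (x + y) \<partial>D)" for x
  proof -
    have "(\<integral>y. 1 - \<phi> x y \<partial>D) = (\<integral>y. b x + b (x + y) - b x * b (x + y) \<partial>D)"
      by (intro Bochner_Integration.integral_cong) (auto simp: \<phi>_def algebra_simps)
    then show ?thesis
      using int_shift by (simp add: D.prob_space)
  qed
  have int: "integrable lborel (\<lambda>x. \<integral>y. 1 - \<phi> x y \<partial>D)"
    unfolding one_minus using int_b avg(1) int_bb
    by (intro Bochner_Integration.integrable_add Bochner_Integration.integrable_diff)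
  have "(\<integral>x. \<integral>y. 1 - \<phi> x y \<partial>D \<partial>lborel)
      = measure lborel B + measure lborel B - (\<integral>x. \<integral>y. b x * b (x + y) \<partial>D \<partial>lborel)"
    unfolding one_minus using int_b avg int_bb integral_b
    by (subst Bochner_Integration.integral_diff Bochner_Integration.integral_add; simp)+
  also have "(\<integral>x. \<integral>y. b x * b (x + y) \<partial>D \<partial>lborel) = (\<integral>y. \<integral>x. b x * b (x + y) \<partial>lborel \<partial>D)"
    by (rule Q.Fubini_integral[OF int_pair])
  finally have exponent: "(\<integral>x. \<integral>y. 1 - \<phi> x y \<partial>D \<partial>lborel)
      = 2 * measure lborel B - (\<integral>y. \<integral>x. b x * b (x + y) \<partial>lborel \<partial>D)"
    by simp
  let ?A = "{\<omega>\<in>space M. \<forall>i. T i \<omega> \<notin> B \<and> T i \<omega> + Y i \<omega> \<notin> B}"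
  have "(\<lambda>n. expectation (\<lambda>\<omega>. \<Prod>i\<in>window n. \<phi> (T i \<omega>) (Y i \<omega>))) \<longlonglongrightarrow> expectation (indicator ?A)"
  proof (rule integral_dominated_convergence[where w="\<lambda>_. 1"])
    show "AE \<omega> in M. norm (\<Prod>i\<in>window n. \<phi> (T i \<omega>) (Y i \<omega>)) \<le> 1" for n
      using \<phi>01 by (auto simp: abs_prod intro!: prod_le_1)
    show "AE \<omega> in M. (\<lambda>n. \<Prod>i\<in>window n. \<phi> (T i \<omega>) (Y i \<omega>)) \<longlonglongrightarrow> indicator ?A \<omega>"
    proof (rule AE_I2)
      fix \<omega> assume \<omega>: "\<omega> \<in> space M"
      show "(\<lambda>n. \<Prod>i\<in>window n. \<phi> (T i \<omega>) (Y i \<omega>)) \<longlonglongrightarrow> indicator ?A \<omega>"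
      proof (cases "\<omega> \<in> ?A")
        case True
        then show ?thesis by (simp add: \<phi>_def b_def)
      next
        case False
        then obtain i where i: "T i \<omega> \<in> B \<or> T i \<omega> + Y i \<omega> \<in> B" using \<omega> by auto
        then have "\<phi> (T i \<omega>) (Y i \<omega>) = 0" by (auto simp: \<phi>_def b_def)
        then have "(\<Prod>i\<in>window n. \<phi> (T i \<omega>) (Y i \<omega>)) = 0" if "nat \<bar>i\<bar> \<le> n" for n
          using in_window_of_large_index[OF that] by (intro prod_zero) auto
        then show ?thesis
          using False by (intro tendsto_eventually eventually_sequentiallyI[of "nat \<bar>i\<bar>"]) simp
      qed
    qed
  qed auto
  from LIMSEQ_unique[OF this marked_poisson_functional[OF T indep Y \<phi>_meas \<phi>01 int]]
  show ?thesis
    by (simp add: exponent b_def)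
qed

end

text \<open>
  For a non-negative random shift \<open>Y\<close> with law \<open>D\<close> this is the mean length of the
  overlap of an interval of length \<open>x\<close> with its shift by \<open>Y\<close>.
\<close>

definition mean_overlap :: "real measure \<Rightarrow> real \<Rightarrow> real" where
  "mean_overlap D x = (\<integral>y. max 0 (x - y) \<partial>D)"

lemma measure_lborel_Ioc: "measure lborel {a<..b::real} = max 0 (b - a)"
  by (cases "a \<le> b") auto

lemma integral_overlap:
  assumes "{x\<in>B. x + y \<in> B} = C" "C \<in> sets borel"
  shows "(\<integral>x. indicator B x * indicator B (x + y) \<partial>lborel) = (measure lborel C :: real)"
proof -
  have "(\<lambda>x. indicator B x * indicator B (x + y) :: real) = indicator C"
    using assms(1) by (auto simp: indicator_def fun_eq_iff)
  then show ?thesis using assms(2) by simp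
qed

lemma overlap_interval:
  assumes "0 \<le> (y::real)"
  shows "(\<integral>u. indicator {0<..x} u * indicator {0<..x} (u + y) \<partial>lborel) = max 0 (x - y)"
proof -
  have "{u\<in>{0<..x}. u + y \<in> {0<..x}} = {0<..x - y}" using assms by auto
  from integral_overlap[OF this] show ?thesis by (simp add: measure_lborel_Ioc)
qed

text \<open>
  The first two summands are the overlaps of the two intervals with their own shifts. The last
  four come from points of the first interval shifted into the second one; the second interval
  cannot be shifted into the first because \<open>y\<close> is non-negative.
\<close>

lemma overlap_two_intervals:
  fixes s t e y :: real
  assumes "0 \<le> s" "0 \<le> t" "0 \<le> e" "0 \<le> y"
  shows "(\<integral>u. indicator ({0<..s} \<union> {s+e<..s+e+t}) u * indicator ({0<..s} \<union> {s+e<..s+e+t}) (u + y) \<partial>lborel)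
    = max 0 (s - y) + max 0 (t - y)
      + (max 0 (s + t + e - y) - max 0 (s + e - y) - max 0 (t + e - y) + max 0 (e - y))"
proof -
  let ?C1 = "{0<..s - y}" and ?C2 = "{s+e<..s+e+t-y}" and ?C3 = "{max 0 (s+e-y)<..min s (s+e+t-y)}"
  have eq: "{u\<in>{0<..s} \<union> {s+e<..s+e+t}. u + y \<in> {0<..s} \<union> {s+e<..s+e+t}} = ?C1 \<union> (?C2 \<union> ?C3)"
    using assms by auto
  have "measure lborel (?C1 \<union> (?C2 \<union> ?C3)) = measure lborel ?C1 + (measure lborel ?C2 + measure lborel ?C3)"
  proof -
    have "measure lborel (?C2 \<union> ?C3) = measure lborel ?C2 + measure lborel ?C3"
      using assms by (intro measure_Union emeasure_bounded_finite[THEN less_imp_neq]) auto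
    moreover have "measure lborel (?C1 \<union> (?C2 \<union> ?C3)) = measure lborel ?C1 + measure lborel (?C2 \<union> ?C3)"
      using assms by (intro measure_Union emeasure_bounded_finite[THEN less_imp_neq]) auto
    ultimately show ?thesis by simp
  qed
  also have "\<dots> = max 0 (s - y) + max 0 (t - y)
      + (max 0 (s + t + e - y) - max 0 (s + e - y) - max 0 (t + e - y) + max 0 (e - y))"
    unfolding measure_lborel_Ioc using assms by (auto simp: max_def min_def)
  finally show ?thesis
    using integral_overlap[OF eq] by simp
qed

locale nonneg_distribution = real_distribution D for D +
  assumes nonneg: "AE y in D. 0 \<le> y"
begin

lemma integrable_excess: "integrable D (\<lambda>y. max 0 (x - y))"
  by (rule integrable_const_bound[where B="\<bar>x\<bar>"]) (use nonneg in \<open>auto elim!: eventually_mono\<close>)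

lemma mean_overlap_zero: "x \<le> 0 \<Longrightarrow> mean_overlap D x = 0"
proof -
  assume "x \<le> 0"
  then have "mean_overlap D x = (\<integral>y. 0 \<partial>D)"
    unfolding mean_overlap_def using nonneg
    by (intro integral_cong_AE) (auto elim!: eventually_mono)
  then show ?thesis by simp
qed

lemma mean_overlap_increment:
  assumes "0 \<le> e"
  shows "e * cdf D x \<le> mean_overlap D (x + e) - mean_overlap D x"
    and "mean_overlap D (x + e) - mean_overlap D x \<le> e * cdf D (x + e)"
proof -
  have diff: "mean_overlap D (x + e) - mean_overlap D x = (\<integral>y. max 0 (x + e - y) - max 0 (x - y) \<partial>D)"
    unfolding mean_overlap_def using integrable_excess by simp
  have ind: "e * cdf D z = (\<integral>y. e * indicator {..z} y \<partial>D)" for z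
    by (simp add: cdf_def)
  have int: "integrable D (\<lambda>y. e * indicator {..z} y)" for z
    by (intro integrable_mult_right integrable_real_indicator) (auto simp: less_top [symmetric])
  show "e * cdf D x \<le> mean_overlap D (x + e) - mean_overlap D x"
    unfolding diff ind using assms integrable_excess int
    by (intro integral_mono) (auto simp: indicator_def)
  show "mean_overlap D (x + e) - mean_overlap D x \<le> e * cdf D (x + e)"
    unfolding diff ind using assms integrable_excess int
    by (intro integral_mono) (auto simp: indicator_def)
qed

text \<open>
  At an atom of \<open>D\<close> only the one-sided derivative exists, which is why the whole argument
  uses limits from the right.
\<close>

lemma mean_overlap_right_derivative:
  "((\<lambda>e. mean_overlap D (x + e)) has_real_derivative cdf D x) (at_right 0)"
  unfolding has_field_derivative_iff
proof (rule tendsto_sandwich)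
  let ?q = "\<lambda>e. (mean_overlap D (x + e) - mean_overlap D (x + 0)) / (e - 0)"
  show "\<forall>\<^sub>F e in at_right 0. cdf D x \<le> ?q e"
    using mean_overlap_increment(1)[of _ x]
    by (auto simp: eventually_at_right_field field_simps intro!: exI[of _ 1])
  show "\<forall>\<^sub>F e in at_right 0. ?q e \<le> cdf D (x + e)"
    using mean_overlap_increment(2)[of _ x]
    by (auto simp: eventually_at_right_field field_simps intro!: exI[of _ 1])
  have "(cdf D \<longlongrightarrow> cdf D x) (at_right x)"
    using cdf_is_right_cont[of x] by (simp add: continuous_within)
  then show "((\<lambda>e. cdf D (x + e)) \<longlongrightarrow> cdf D x) (at_right 0)"
    by (subst (asm) filterlim_at_right_to_0) (simp add: add.commute)
qed auto

end

section \<open>The first point of a stationary renewal process\<close>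

context prob_space
begin

text \<open>
  The first point \<open>S 0\<close> is independent of the later points seen from it. With
  \<open>w x\<close> the probability that no \<open>S k - S 0\<close> lies in \<open>{x<..x+t}\<close>, the
  event has probability \<open>\<integral>v\<in>{s<..s+e}. f v * w (s+e-v)\<close>, so the witness is
  \<open>I e = \<integral>x\<in>{0..<e}. w x\<close>, which does not depend on \<open>s\<close>. The density
  \<open>f\<close> is antitone, as every equilibrium density is, and its values on the interval are
  bounded by those at the end points.
\<close>

lemma antitone_density_sandwich:
  fixes S :: "nat \<Rightarrow> 'a \<Rightarrow> real" and f :: "real \<Rightarrow> real"
  assumes indep: "indep_vars (\<lambda>_. borel)
          (\<lambda>k \<omega>. case k of 0 \<Rightarrow> S 0 \<omega> | Suc j \<Rightarrow> S (Suc j) \<omega> - S j \<omega>) UNIV"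
    and dist: "distributed M lborel (S 0) (\<lambda>x. ennreal (indicator {0<..} x * f x))"
    and f: "\<And>x. 0 \<le> f x" "antimono f"
  obtains I :: "real \<Rightarrow> real" where
    "\<And>e. 0 \<le> I e"
    "\<And>s e. 0 \<le> s \<Longrightarrow> 0 < e \<Longrightarrow>
      f (s + e) * I e \<le> prob {\<omega>\<in>space M. S 0 \<omega> \<in> {s<..s+e} \<and> (\<forall>k. S k \<omega> \<notin> {s+e<..s+e+t})}"
    "\<And>s e. 0 \<le> s \<Longrightarrow> 0 < e \<Longrightarrow>
      prob {\<omega>\<in>space M. S 0 \<omega> \<in> {s<..s+e} \<and> (\<forall>k. S k \<omega> \<notin> {s+e<..s+e+t})} \<le> f s * I e"
    "t = 0 \<Longrightarrow> (\<And>e. 0 < e \<Longrightarrow> I e = e)"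
proof -
  let ?gap = "\<lambda>k \<omega>. case k of 0 \<Rightarrow> S 0 \<omega> | Suc j \<Rightarrow> S (Suc j) \<omega> - S j \<omega>"
  let ?P = "\<Pi>\<^sub>M i\<in>(UNIV :: nat set). (borel :: real measure)"
  let ?R = "\<lambda>\<omega> k. S k \<omega> - S 0 \<omega>"
  have R_eq: "?R \<omega> k = (\<Sum>j<k. ?gap (Suc j) \<omega>)" for \<omega> k
    using sum_lessThan_telescope[of "\<lambda>k. S k \<omega>" k] by simp
  \<comment> \<open>Both members of an independent pair must have the same type, hence the constant sequence \<open>?S\<close>.\<close>
  let ?S = "\<lambda>\<omega> (k :: nat). S 0 \<omega>"
  have "indep_var ?P ((\<lambda>z (k :: nat). z 0) \<circ> (\<lambda>\<omega>. restrict (\<lambda>i. ?gap i \<omega>) {0}))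
      ?P ((\<lambda>z k. \<Sum>j<k. z (Suc j)) \<circ> (\<lambda>\<omega>. restrict (\<lambda>i. ?gap i \<omega>) {1..}))"
  proof (rule indep_var_compose[OF indep_var_restrict[OF indep]])
    show "(\<lambda>z k. \<Sum>j<k. z (Suc j)) \<in> measurable (Pi\<^sub>M {1..} (\<lambda>_. borel)) ?P"
      by (intro measurable_PiM_single') (auto intro!: borel_measurable_sum measurable_component_singleton)
    show "(\<lambda>z k. z 0) \<in> measurable (Pi\<^sub>M {0} (\<lambda>_. borel)) ?P"
      by (intro measurable_PiM_single') (auto intro!: measurable_component_singleton)
  qed auto
  moreover have "(\<lambda>z k. z 0) \<circ> (\<lambda>\<omega>. restrict (\<lambda>i. ?gap i \<omega>) {0}) = ?S"
    by (simp add: fun_eq_iff)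
  moreover have "(\<lambda>z k. \<Sum>j<k. z (Suc j)) \<circ> (\<lambda>\<omega>. restrict (\<lambda>i. ?gap i \<omega>) {1..}) = ?R"
    by (rule ext)+ (simp add: R_eq)
  ultimately have ind: "indep_var ?P ?S ?P ?R" by simp
  then have [measurable]: "?S \<in> measurable M ?P" "?R \<in> measurable M ?P"
    and joint: "distr M ?P ?S \<Otimes>\<^sub>M distr M ?P ?R = distr M (?P \<Otimes>\<^sub>M ?P) (\<lambda>\<omega>. (?S \<omega>, ?R \<omega>))"
    by (auto simp: indep_var_distribution_eq)
  have [measurable]: "S 0 \<in> borel_measurable M"
    using dist by (simp add: distributed_def)
  define Q where "Q = distr M ?P ?R"
  have sets_Q [measurable_cong]: "sets Q = sets ?P" by (simp add: Q_def)
  have space_Q: "space Q = UNIV" by (simp add: Q_def space_PiM)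
  interpret Q: prob_space Q unfolding Q_def by (rule prob_space_distr) measurable
  have S0: "distr M lborel (S 0) = density lborel (\<lambda>x. ennreal (indicator {0<..} x * f x))"
    using dist by (simp add: distributed_def)
  have S0': "distr M borel (S 0) = density lborel (\<lambda>x. ennreal (indicator {0<..} x * f x))"
    unfolding S0[symmetric] by (rule distr_cong) auto
  have [measurable]: "f \<in> borel_measurable borel"
  proof -
    have "mono (\<lambda>x. - f x)" using f(2) by (auto simp: monotone_def)
    then have "(\<lambda>x. - f x) \<in> borel_measurable borel" by (rule borel_measurable_mono)
    from borel_measurable_uminus[OF this] show ?thesis by simp
  qed
  have coord [measurable]: "(\<lambda>p. snd p k) \<in> borel_measurable (N \<Otimes>\<^sub>M ?P)" for k and N :: "'b measure"
    by (rule measurable_compose[OF measurable_snd measurable_component_singleton]) simp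
  have coord0 [measurable]: "(\<lambda>p. fst p k) \<in> borel_measurable (?P \<Otimes>\<^sub>M ?P)" for k
    by (rule measurable_compose[OF measurable_fst measurable_component_singleton]) simp
  define W where "W x = emeasure Q {\<rho>. \<forall>k. \<rho> k \<notin> {x<..x+t}}" for x
  have W_meas [measurable]: "W \<in> borel_measurable borel"
  proof -
    have "{(x, \<rho>). \<forall>k. \<rho> k \<notin> {x<..x+t}} \<in> sets (borel \<Otimes>\<^sub>M Q)"
    proof -
      have "{p \<in> space (borel \<Otimes>\<^sub>M ?P). \<forall>k. \<not> (fst p < snd p k \<and> snd p k \<le> fst p + t)} \<in> sets (borel \<Otimes>\<^sub>M ?P)"
        by measurable
      then show ?thesis
        by (simp add: space_pair_measure space_PiM split_beta' sets_Q cong: sets_pair_measure_cong)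
    qed
    from Q.measurable_emeasure_Pair[OF this] show ?thesis
      by (simp add: W_def[abs_def] vimage_def)
  qed
  define J where "J e = (\<integral>\<^sup>+x. indicator {0..<e} x * W x \<partial>lborel)" for e :: real
  have W_le: "W x \<le> 1" for x
    unfolding W_def by (rule Q.emeasure_le_1)
  have J_le: "J e \<le> ennreal e" if "0 < e" for e
  proof -
    have "J e \<le> (\<integral>\<^sup>+x. indicator {0..<e} x \<partial>lborel)"
      unfolding J_def using W_le by (intro nn_integral_mono) (auto simp: indicator_def)
    then show ?thesis using that by simp
  qed
  have J_shift: "(\<integral>\<^sup>+v. indicator {s<..s+e} v * W (s + e - v) \<partial>lborel) = J e" for s e
    unfolding J_def
    by (subst nn_integral_real_affine[where c="-1" and t="s+e"])
       (auto simp: indicator_def intro!: nn_integral_cong)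
  let ?A = "\<lambda>s e. {\<omega>\<in>space M. S 0 \<omega> \<in> {s<..s+e} \<and> (\<forall>k. S k \<omega> \<notin> {s+e<..s+e+t})}"
  have A: "emeasure M (?A s e) = (\<integral>\<^sup>+v. ennreal (f v) * (indicator {s<..s+e} v * W (s + e - v)) \<partial>lborel)"
    if s: "0 \<le> s" for s e
  proof -
    let ?E = "{(u, \<rho>). u 0 \<in> {s<..s+e} \<and> (\<forall>k. \<rho> k \<notin> {s+e-u 0<..s+e-u 0+t})}"
    have E: "?E \<in> sets (?P \<Otimes>\<^sub>M ?P)"
    proof -
      have "{p \<in> space (?P \<Otimes>\<^sub>M ?P). (s < fst p 0 \<and> fst p 0 \<le> s + e) \<and>
          (\<forall>k. \<not> (s + e - fst p 0 < snd p k \<and> snd p k \<le> s + e - fst p 0 + t))} \<in> sets (?P \<Otimes>\<^sub>M ?P)"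
        by measurable
      then show ?thesis by (simp add: space_pair_measure space_PiM split_beta')
    qed
    have "emeasure M (?A s e) = emeasure (distr M (?P \<Otimes>\<^sub>M ?P) (\<lambda>\<omega>. (?S \<omega>, ?R \<omega>))) ?E"
      by (subst emeasure_distr[OF _ E]) (auto intro!: arg_cong[where f="emeasure M"])
    also have "\<dots> = emeasure (distr M ?P ?S \<Otimes>\<^sub>M Q) ?E"
      by (simp add: joint Q_def)
    also have "\<dots> = (\<integral>\<^sup>+u. emeasure Q (Pair u -` ?E) \<partial>distr M ?P ?S)"
      using E by (intro Q.emeasure_pair_measure_alt) (simp add: sets_Q cong: sets_pair_measure_cong)
    also have "\<dots> = (\<integral>\<^sup>+u. indicator {s<..s+e} (u 0) * W (s + e - u 0) \<partial>distr M ?P ?S)"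
      by (intro nn_integral_cong) (auto simp: W_def indicator_def vimage_def)
    also have "\<dots> = (\<integral>\<^sup>+v. indicator {s<..s+e} v * W (s + e - v) \<partial>distr M borel (S 0))"
      by (simp add: nn_integral_distr)
    also have "\<dots> = (\<integral>\<^sup>+v. ennreal (indicator {0<..} v * f v) * (indicator {s<..s+e} v * W (s + e - v)) \<partial>lborel)"
      unfolding S0' by (subst nn_integral_density) auto
    also have "\<dots> = (\<integral>\<^sup>+v. ennreal (f v) * (indicator {s<..s+e} v * W (s + e - v)) \<partial>lborel)"
      using s by (intro nn_integral_cong) (auto simp: indicator_def)
    finally show ?thesis .
  qed
  define I where "I e = enn2real (J e)" for e
  have I_nonneg: "0 \<le> I e" for e by (simp add: I_def)
  have J_fin: "J e = ennreal (I e)" if "0 < e" for e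
    unfolding I_def using J_le[OF that] by (intro ennreal_enn2real[symmetric]) (auto simp: less_top[symmetric] top_unique)
  show thesis
  proof (rule that[of I])
    show "0 \<le> I e" for e by (rule I_nonneg)
    fix s e :: real assume s: "0 \<le> s" and e: "0 < e"
    have "ennreal (f (s + e) * I e) = (\<integral>\<^sup>+v. ennreal (f (s + e)) * (indicator {s<..s+e} v * W (s + e - v)) \<partial>lborel)"
      using f by (subst nn_integral_cmult) (auto simp: J_shift J_fin[OF e] ennreal_mult' I_nonneg)
    also have "\<dots> \<le> emeasure M (?A s e)"
      unfolding A[OF s] using f(2)
      by (intro nn_integral_mono) (auto simp: indicator_def antimonoD intro!: mult_right_mono ennreal_leI)
    finally show "f (s + e) * I e \<le> prob (?A s e)"
      by (simp add: emeasure_eq_measure)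
    have "emeasure M (?A s e) \<le> (\<integral>\<^sup>+v. ennreal (f s) * (indicator {s<..s+e} v * W (s + e - v)) \<partial>lborel)"
      unfolding A[OF s] using f(2)
      by (intro nn_integral_mono) (auto simp: indicator_def antimonoD intro!: mult_right_mono ennreal_leI)
    also have "\<dots> = ennreal (f s * I e)"
      using f by (subst nn_integral_cmult) (auto simp: J_shift J_fin[OF e] ennreal_mult' I_nonneg)
    finally show "prob (?A s e) \<le> f s * I e"
      using f by (simp add: emeasure_eq_measure I_nonneg)
  next
    fix e :: real assume "t = 0" "0 < e"
    have "W x = 1" for x
      using \<open>t = 0\<close> Q.emeasure_space_1 by (simp add: W_def space_Q)
    then show "I e = e"
      using \<open>0 < e\<close> by (simp add: I_def J_def)
  qed
qed

end

section \<open>The void probabilities do not factorize\<close>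

lemma right_derivative_cong:
  fixes f g :: "real \<Rightarrow> real"
  assumes f: "(f has_real_derivative d) (at_right x)" and eq: "\<And>y. x \<le> y \<Longrightarrow> f y = g y"
  shows "(g has_real_derivative d) (at_right x)"
  unfolding has_field_derivative_iff
proof (rule Lim_transform_eventually)
  show "((\<lambda>y. (f y - f x) / (y - x)) \<longlongrightarrow> d) (at_right x)"
    using f unfolding has_field_derivative_iff .
  show "\<forall>\<^sub>F y in at_right x. (f y - f x) / (y - x) = (g y - g x) / (y - x)"
    using eventually_at_right_less[of x] by eventually_elim (simp add: eq)
qed

context nonneg_distribution
begin

text \<open>
  The probabilities that the superposition of a Poisson process of rate \<open>r\<close> with its delayed
  copy has no point in \<open>{0<..x}\<close>, or no point in
  \<open>{0<..s} \<union> {s+e<..s+e+t}\<close>.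
\<close>

definition interval_void_prob :: "real \<Rightarrow> real \<Rightarrow> real" where
  "interval_void_prob r x = exp (- r * (2 * x - mean_overlap D x))"

definition two_interval_void_prob :: "real \<Rightarrow> real \<Rightarrow> real \<Rightarrow> real \<Rightarrow> real" where
  "two_interval_void_prob r s t e = exp (- r * (2 * (s + t) - (mean_overlap D s + mean_overlap D t
      + (mean_overlap D (s + t + e) - mean_overlap D (s + e) - mean_overlap D (t + e) + mean_overlap D e))))"

text \<open>
  The difference is the probability that the first point falls into \<open>{s<..s+e}\<close> and that
  \<open>{s+e<..s+e+t}\<close> is empty. Its derivative at \<open>e = 0\<close> is thus the density of
  a first point at \<open>s\<close> that is followed by an empty interval of length \<open>t\<close>.
\<close>

lemma void_difference_right_derivative:
  "((\<lambda>e. (two_interval_void_prob r s t e - interval_void_prob r (s + t + e)) / e)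
      \<longlongrightarrow> r * interval_void_prob r (s + t) * (2 - cdf D s - cdf D t + cdf D 0)) (at_right 0)"
proof -
  have d0: "((\<lambda>e. mean_overlap D e) has_real_derivative cdf D 0) (at_right 0)"
    using mean_overlap_right_derivative[of 0] by simp
  have "((\<lambda>e. two_interval_void_prob r s t e - interval_void_prob r (s + t + e)) has_real_derivative
      r * interval_void_prob r (s + t) * (2 - cdf D s - cdf D t + cdf D 0)) (at_right 0)"
    unfolding interval_void_prob_def two_interval_void_prob_def
    by (rule derivative_eq_intros mean_overlap_right_derivative d0 refl)+
       (simp add: mean_overlap_zero algebra_simps)
  moreover have "two_interval_void_prob r s t 0 - interval_void_prob r (s + t + 0) = 0"
    by (simp add: interval_void_prob_def two_interval_void_prob_def mean_overlap_zero)
  ultimately show ?thesis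
    unfolding has_field_derivative_iff by simp
qed

lemma mean_overlap_tail: "0 \<le> s \<Longrightarrow> ((\<lambda>t. mean_overlap D (t + s) - mean_overlap D t) \<longlongrightarrow> s) at_top"
proof (rule tendsto_sandwich)
  assume s: "0 \<le> s"
  show "\<forall>\<^sub>F t in at_top. s * cdf D t \<le> mean_overlap D (t + s) - mean_overlap D t"
    using mean_overlap_increment(1)[OF s] by simp
  show "\<forall>\<^sub>F t in at_top. mean_overlap D (t + s) - mean_overlap D t \<le> s * 1"
    using mean_overlap_increment(2)[OF s] cdf_bounded_prob s
    by (intro always_eventually allI) (meson mult_left_mono order_trans)
  show "((\<lambda>t. s * cdf D t) \<longlongrightarrow> s) at_top"
    using tendsto_mult[OF tendsto_const cdf_lim_at_top_prob, of s] by simp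
qed auto

text \<open>
  The analytic core. Let \<open>F\<close> be the distribution function, \<open>a = F 0\<close>,
  \<open>E s = exp (- r * (s - mean_overlap D s))\<close> and \<open>\<rho> s = 1 + a - F s\<close>. Letting
  \<open>t\<close> tend to infinity in the product relation yields
  \<open>(2 - a) * \<rho> s = E s * (2 - F s)\<close>, and this turns the relation into
  \<open>E (s + t) * (\<rho> s + \<rho> t - a) = (2 - a) * \<rho> s * \<rho> t\<close>. The first equation
  expresses \<open>\<rho>\<close> by \<open>E\<close>, so \<open>\<rho>\<close> is differentiable from the right, and
  differentiating the second one at \<open>t = 0\<close> gives \<open>(F s - a) * (1 - F s) = 0\<close>.
  Hence \<open>F\<close> equals \<open>a\<close> on some \<open>{0<..s}\<close>. Then \<open>E s = 1\<close>, so the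
  mean overlap of an interval of length \<open>s\<close> is \<open>s\<close>, although it is at most
  \<open>s * F s\<close>.
\<close>

lemma void_product_impossible:
  assumes r: "0 < r" and a: "cdf D 0 < 1"
    and product: "\<And>s t. 0 \<le> s \<Longrightarrow> 0 \<le> t \<Longrightarrow>
      interval_void_prob r (s + t) * (2 - cdf D s - cdf D t + cdf D 0) * (2 - cdf D 0)
        = interval_void_prob r s * (2 - cdf D s) * (interval_void_prob r t * (2 - cdf D t))"
  shows False
proof -
  define a where "a = cdf D 0"
  define E where "E s = exp (- r * (s - mean_overlap D s))" for s
  define \<rho> where "\<rho> s = 1 + a - cdf D s" for s
  have a01: "0 \<le> a" "a < 1" using a by (auto simp: a_def cdf_nonneg)
  have cdf_ge: "a \<le> cdf D s" if "0 \<le> s" for s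
    unfolding a_def using that by (rule cdf_nondecreasing)
  have cdf_le: "cdf D s \<le> 1" for s by (rule cdf_bounded_prob)
  have interval_void_prob_E: "interval_void_prob r s = exp (- r * s) * E s" for s
    by (simp add: interval_void_prob_def E_def exp_add [symmetric] algebra_simps)
  have E_pos: "0 < E s" for s by (simp add: E_def)
  have E_le: "E s \<le> 1" if "0 \<le> s" for s
  proof -
    have "mean_overlap D (0 + s) - mean_overlap D 0 \<le> s * cdf D (0 + s)"
      by (rule mean_overlap_increment(2)[OF that])
    also have "\<dots> \<le> s" using that cdf_le[of "0 + s"] by (simp add: mult_left_le)
    finally show ?thesis using r by (simp add: E_def mean_overlap_zero)
  qed
  \<comment> \<open>The factor \<open>interval_void_prob r t\<close> cancels before \<open>t\<close> tends to infinity.\<close>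
  have star: "(2 - a) * \<rho> s = E s * (2 - cdf D s)" if s: "0 \<le> s" for s
  proof -
    have lim1: "((\<lambda>t. exp (- r * (2 * s - (mean_overlap D (t + s) - mean_overlap D t)))
          * (2 - cdf D s - cdf D t + a) * (2 - a))
        \<longlongrightarrow> exp (- r * (2 * s - s)) * (2 - cdf D s - 1 + a) * (2 - a)) at_top"
      by (intro tendsto_intros mean_overlap_tail s cdf_lim_at_top_prob)
    have lim2: "((\<lambda>t. interval_void_prob r s * (2 - cdf D s) * (2 - cdf D t))
        \<longlongrightarrow> interval_void_prob r s * (2 - cdf D s) * (2 - 1)) at_top"
      by (intro tendsto_intros cdf_lim_at_top_prob)
    have "\<forall>\<^sub>F t in at_top. exp (- r * (2 * s - (mean_overlap D (t + s) - mean_overlap D t)))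
          * (2 - cdf D s - cdf D t + a) * (2 - a) = interval_void_prob r s * (2 - cdf D s) * (2 - cdf D t)"
      using eventually_ge_at_top[of 0]
    proof eventually_elim
      fix t :: real assume t: "0 \<le> t"
      have "interval_void_prob r (s + t) = interval_void_prob r t * exp (- r * (2 * s - (mean_overlap D (t + s) - mean_overlap D t)))"
        by (simp add: interval_void_prob_def exp_add [symmetric] algebra_simps)
      moreover have "interval_void_prob r t \<noteq> 0" by (simp add: interval_void_prob_def)
      ultimately show "exp (- r * (2 * s - (mean_overlap D (t + s) - mean_overlap D t)))
          * (2 - cdf D s - cdf D t + a) * (2 - a) = interval_void_prob r s * (2 - cdf D s) * (2 - cdf D t)"
        using product[OF s t] by (simp add: a_def mult_ac)
    qed
    from tendsto_unique[OF trivial_limit_at_top_linorder Lim_transform_eventually[OF lim1 this] lim2]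
    have "exp (- r * (2 * s - s)) * (2 - cdf D s - 1 + a) * (2 - a)
        = interval_void_prob r s * (2 - cdf D s) * (2 - 1)" .
    then have "exp (- r * s) * ((2 - a) * \<rho> s) = exp (- r * s) * (E s * (2 - cdf D s))"
      by (simp add: interval_void_prob_E \<rho>_def algebra_simps)
    then show ?thesis by simp
  qed
  \<comment> \<open>The exponential factors \<open>exp (- r * s)\<close> and \<open>exp (- r * t)\<close> cancel.\<close>
  have dstar: "E (s + t) * (\<rho> s + \<rho> t - a) = (2 - a) * \<rho> s * \<rho> t" if s: "0 \<le> s" and t: "0 \<le> t" for s t
  proof -
    have "exp (- r * (s + t)) * (E (s + t) * (\<rho> s + \<rho> t - a) * (2 - a))
        = exp (- r * (s + t)) * (E s * (2 - cdf D s) * (E t * (2 - cdf D t)))"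
    proof -
      have "exp (- r * (s + t)) = exp (- r * s) * exp (- r * t)"
        by (simp add: exp_add [symmetric] algebra_simps)
      moreover have sum: "\<rho> s + \<rho> t - a = 2 - cdf D s - cdf D t + a" by (simp add: \<rho>_def)
      ultimately show ?thesis
        using product[OF s t] unfolding sum interval_void_prob_E a_def[symmetric] by (simp add: mult_ac)
    qed
    then have "(2 - a) * (E (s + t) * (\<rho> s + \<rho> t - a)) = (2 - a) * ((2 - a) * \<rho> s * \<rho> t)"
      using star[OF s] star[OF t] by (simp add: mult_ac)
    then show ?thesis using a01 by simp
  qed
  have \<rho>_E: "\<rho> t = (1 - a) * E t / (2 - a - E t)" if "0 \<le> t" for t
    using star[OF that] E_le[OF that] a01 by (simp add: \<rho>_def field_simps)
  have E_deriv: "((\<lambda>e. E (s + e)) has_real_derivative - r * (1 - cdf D s) * E s) (at_right 0)" for s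
    unfolding E_def
    by (auto intro!: derivative_eq_intros mean_overlap_right_derivative)
  have E0: "E 0 = 1" by (simp add: E_def mean_overlap_zero)
  have \<rho>0: "\<rho> 0 = 1" by (simp add: \<rho>_def a_def)
  have \<rho>_deriv: "(\<rho> has_real_derivative - r * (2 - a)) (at_right 0)"
  proof -
    have "((\<lambda>t. (1 - a) * E t / (2 - a - E t)) has_real_derivative - r * (2 - a)) (at_right 0)"
    proof -
      have E': "((\<lambda>e. E e) has_real_derivative - r * (1 - a)) (at_right 0)"
        using E_deriv[of 0] by (simp add: E0 a_def)
      define b where "b = 1 - a"
      have b: "1 - a = b" "2 - a = 1 + b" "b \<noteq> 0"
        using a01 by (auto simp: b_def)
      show ?thesis
        unfolding b by (rule derivative_eq_intros E'[unfolded b] refl)+ (use b(3) in \<open>simp_all add: E0 field_simps\<close>)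
    qed
    then show ?thesis
      by (rule right_derivative_cong) (simp add: \<rho>_E)
  qed
  have two_values: "cdf D s = a \<or> cdf D s = 1" if s: "0 \<le> s" for s
  proof -
    have "((\<lambda>t. E (s + t) * (\<rho> s + \<rho> t - a)) has_real_derivative
        - r * (1 - cdf D s) * E s * (\<rho> s + 1 - a) + E s * (- r * (2 - a))) (at_right 0)"
      by (auto intro!: derivative_eq_intros E_deriv \<rho>_deriv simp: \<rho>0)
    moreover have "((\<lambda>t. (2 - a) * \<rho> s * \<rho> t) has_real_derivative (2 - a) * \<rho> s * (- r * (2 - a))) (at_right 0)"
      by (auto intro!: derivative_eq_intros \<rho>_deriv)
    then have "((\<lambda>t. E (s + t) * (\<rho> s + \<rho> t - a)) has_real_derivative (2 - a) * \<rho> s * (- r * (2 - a))) (at_right 0)"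
      by (rule right_derivative_cong) (simp add: dstar s)
    ultimately have "- r * (1 - cdf D s) * E s * (\<rho> s + 1 - a) + E s * (- r * (2 - a))
        = (2 - a) * \<rho> s * (- r * (2 - a))"
      by (rule has_field_derivative_unique) simp
    then have "- r * ((1 - cdf D s) * (E s * (\<rho> s + 1 - a)) + E s * (2 - a)) = - r * ((2 - a) * \<rho> s * (2 - a))"
      by (simp add: algebra_simps)
    then have sum: "(1 - cdf D s) * (E s * (\<rho> s + 1 - a)) + E s * (2 - a) = (2 - a) * \<rho> s * (2 - a)"
      using r by (simp only: mult_cancel_left) auto
    have "E s * (\<rho> s + 1 - a) = (2 - a) * \<rho> s"
      using star[OF s] by (simp add: \<rho>_def)
    from sum[unfolded this] have "(2 - a) * ((1 - cdf D s) * \<rho> s + E s) = (2 - a) * ((2 - a) * \<rho> s)"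
      by (simp add: algebra_simps)
    then have "(1 - cdf D s) * \<rho> s + E s = (2 - a) * \<rho> s"
      using a01 by simp
    then have "E s = \<rho> s * (1 - a + cdf D s)" by (simp add: algebra_simps)
    then have "(2 - a) * \<rho> s = \<rho> s * ((1 - a + cdf D s) * (2 - cdf D s))"
      using star[OF s] by simp
    moreover have "0 < \<rho> s"
    proof -
      have "0 < E s * (2 - cdf D s)"
        using E_pos[of s] cdf_le[of s] by (intro mult_pos_pos) auto
      then have "0 < (2 - a) * \<rho> s" using star[OF s] by simp
      then show ?thesis using a01 by (simp add: zero_less_mult_iff)
    qed
    ultimately have "2 - a = (1 - a + cdf D s) * (2 - cdf D s)" by simp
    then have "(cdf D s - a) * (1 - cdf D s) = 0" by (simp add: algebra_simps)
    then show ?thesis by auto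
  qed
  have "(cdf D \<longlongrightarrow> a) (at_right 0)"
    using cdf_is_right_cont[of 0] by (simp add: continuous_within a_def)
  then have "\<forall>\<^sub>F s in at_right 0. cdf D s < 1"
    using a01 by (intro order_tendstoD)
  then obtain s where s: "0 < s" "cdf D s < 1"
    by (auto simp: eventually_at_right_field dest: dense)
  then have cdf_s: "cdf D s = a" using two_values[of s] by auto
  then have "E s = 1"
    using star[of s] s a01 by (simp add: \<rho>_def)
  then have "s = mean_overlap D s" using r by (simp add: E_def)
  moreover have "mean_overlap D (0 + s) - mean_overlap D 0 \<le> s * cdf D (0 + s)"
    using s by (intro mean_overlap_increment(2)) auto
  ultimately have "s \<le> s * a" by (simp add: cdf_s mean_overlap_zero)
  then show False using s a01 by simp
qed

end

section \<open>The aggregate process is not a renewal process\<close>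

text \<open>
  If \<open>p s t e\<close> behaves like \<open>f s * I t e\<close> for small \<open>e\<close>, then its rate
  \<open>d s t\<close> is a product of a function of \<open>s\<close> and a function of \<open>t\<close>. The
  factor \<open>I t e\<close>, whose limiting behaviour is unknown, is eliminated by comparing
  \<open>p s t e\<close> with \<open>p 0 t e\<close>.
\<close>

lemma sandwich_limit_product:
  fixes P d :: "real \<Rightarrow> real \<Rightarrow> real" and p :: "real \<Rightarrow> real \<Rightarrow> real \<Rightarrow> real" and f :: "real \<Rightarrow> real"
  assumes lim: "\<And>s t. 0 \<le> s \<Longrightarrow> 0 \<le> t \<Longrightarrow> ((\<lambda>e. p s t e / e) \<longlongrightarrow> d s t) (at_right 0)"
    and lower: "\<And>s t e. 0 \<le> s \<Longrightarrow> 0 \<le> t \<Longrightarrow> 0 < e \<Longrightarrow> f (s + e) * I t e \<le> p s t e"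
    and upper: "\<And>s t e. 0 \<le> s \<Longrightarrow> 0 \<le> t \<Longrightarrow> 0 < e \<Longrightarrow> p s t e \<le> f s * I t e"
    and I0: "\<And>e. 0 < e \<Longrightarrow> I 0 e = e"
    and f: "\<And>x. 0 \<le> f x" "\<And>s. ((\<lambda>e. f (s + e)) \<longlongrightarrow> f s) (at_right 0)"
    and s: "0 \<le> s" and t: "0 \<le> t"
  shows "d s t * d 0 0 = d s 0 * d 0 t"
proof -
  have near: "\<forall>\<^sub>F e in at_right (0::real). Q e" if "\<And>e. 0 < e \<Longrightarrow> Q e" for Q
    using that by (auto simp: eventually_at_right_field intro!: exI[of _ 1])
  have d_f: "d u 0 = f u" if u: "0 \<le> u" for u
  proof (rule tendsto_unique[OF trivial_limit_at_right_real lim[OF u]])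
    show "((\<lambda>e. p u 0 e / e) \<longlongrightarrow> f u) (at_right 0)"
    proof (rule tendsto_sandwich[OF _ _ f(2) tendsto_const])
      show "\<forall>\<^sub>F e in at_right 0. f (u + e) \<le> p u 0 e / e"
        by (rule near) (use lower[OF u, of 0] I0 in \<open>auto simp: field_simps\<close>)
      show "\<forall>\<^sub>F e in at_right 0. p u 0 e / e \<le> f u"
        by (rule near) (use upper[OF u, of 0] I0 in \<open>auto simp: field_simps\<close>)
    qed
  qed simp
  have le: "d s t * f 0 \<le> f s * d 0 t"
  proof (rule tendsto_le[OF trivial_limit_at_right_real])
    show "((\<lambda>e. p s t e / e * f (0 + e)) \<longlongrightarrow> d s t * f 0) (at_right 0)"
      by (intro tendsto_mult lim f s t)
    show "((\<lambda>e. f s * (p 0 t e / e)) \<longlongrightarrow> f s * d 0 t) (at_right 0)"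
      by (intro tendsto_mult tendsto_const lim order_refl t)
    show "\<forall>\<^sub>F e in at_right 0. p s t e / e * f (0 + e) \<le> f s * (p 0 t e / e)"
    proof (rule near)
      fix e :: real assume e: "0 < e"
      have "p s t e * f (0 + e) \<le> f s * I t e * f (0 + e)"
        by (intro mult_right_mono upper f s t e)
      also have "\<dots> = f s * (f (0 + e) * I t e)" by simp
      also have "\<dots> \<le> f s * p 0 t e"
        by (intro mult_left_mono lower f order_refl t e)
      finally show "p s t e / e * f (0 + e) \<le> f s * (p 0 t e / e)"
        using e by (simp add: divide_right_mono)
    qed
  qed
  have ge: "f s * d 0 t \<le> d s t * f 0"
  proof (rule tendsto_le[OF trivial_limit_at_right_real])
    show "((\<lambda>e. p s t e / e * f 0) \<longlongrightarrow> d s t * f 0) (at_right 0)"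
      by (intro tendsto_mult tendsto_const lim s t)
    show "((\<lambda>e. f (s + e) * (p 0 t e / e)) \<longlongrightarrow> f s * d 0 t) (at_right 0)"
      by (intro tendsto_mult f lim order_refl t)
    show "\<forall>\<^sub>F e in at_right 0. f (s + e) * (p 0 t e / e) \<le> p s t e / e * f 0"
    proof (rule near)
      fix e :: real assume e: "0 < e"
      have "f (s + e) * p 0 t e \<le> f (s + e) * (f 0 * I t e)"
        by (intro mult_left_mono upper f order_refl t e)
      also have "\<dots> = f (s + e) * I t e * f 0" by simp
      also have "\<dots> \<le> p s t e * f 0"
        by (intro mult_right_mono lower f s t e)
      finally show "f (s + e) * (p 0 t e / e) \<le> p s t e / e * f 0"
        using e by (simp add: divide_right_mono)
    qed
  qed
  show ?thesis
    using le ge by (simp add: d_f s)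
qed

lemma successive_points_void:
  assumes "successive_points x s" "B \<subseteq> {0<..}"
  shows "(\<forall>i. x i \<notin> B) \<longleftrightarrow> (\<forall>k. s k \<notin> B)"
proof -
  obtain \<pi> where \<pi>: "bij_betw \<pi> UNIV {i. 0 < x i}" "\<And>k. s k = x (\<pi> k)"
    using assms(1) by (auto simp: successive_points_def)
  have "\<exists>k. s k = x i" if "x i \<in> B" for i
  proof -
    have "i \<in> {i. 0 < x i}" using that assms(2) by auto
    then obtain k where "i = \<pi> k" using \<pi>(1) by (auto simp: bij_betw_def)
    then show ?thesis using \<pi>(2) by auto
  qed
  then show ?thesis using \<pi>(2) by metis
qed

lemma successive_points_pos: "successive_points x s \<Longrightarrow> 0 < s k"
  unfolding successive_points_def bij_betw_def by auto

text \<open>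
  Expresses an event about the first point by the emptiness of two sets, whose probabilities are
  known for the superposition.
\<close>

lemma successive_points_first_point:
  assumes x: "successive_points x p" and s: "0 \<le> s" and t: "0 \<le> t" and e: "0 < e"
  shows "(\<forall>i. x i \<notin> {0<..s} \<union> {s+e<..s+e+t}) \<and> \<not> (\<forall>i. x i \<notin> {0<..s+t+e})
    \<longleftrightarrow> p 0 \<in> {s<..s+e} \<and> (\<forall>k. p k \<notin> {s+e<..s+e+t})"
proof -
  have inc: "p 0 \<le> p k" for k
    using x by (auto simp: successive_points_def incseq_def)
  have pos: "0 < p k" for k using successive_points_pos[OF x] .
  have "(\<forall>i. x i \<notin> {0<..s} \<union> {s+e<..s+e+t}) \<longleftrightarrow> (\<forall>k. p k \<notin> {0<..s} \<union> {s+e<..s+e+t})"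
    using s e by (intro successive_points_void[OF x]) auto
  moreover have "(\<forall>i. x i \<notin> {0<..s+t+e}) \<longleftrightarrow> (\<forall>k. p k \<notin> {0<..s+t+e})"
    by (intro successive_points_void[OF x]) auto
  moreover have "(\<forall>k. p k \<notin> {0<..s} \<union> {s+e<..s+e+t}) \<and> \<not> (\<forall>k. p k \<notin> {0<..s+t+e})
    \<longleftrightarrow> p 0 \<in> {s<..s+e} \<and> (\<forall>k. p k \<notin> {s+e<..s+e+t})" (is "?L \<longleftrightarrow> ?R")
  proof
    assume L: ?L
    then obtain k where k: "p k \<le> s + t + e" by auto
    have "p k \<le> s + e" using L k pos[of k] by (auto simp: not_less dest!: spec[of _ k])
    then have "p 0 \<le> s + e" using inc[of k] by simp
    moreover have "s < p 0" using L pos[of 0] by (auto dest!: spec[of _ 0])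
    ultimately show ?R using L by auto
  next
    assume R: ?R
    have "s < p k" for k using R inc[of k] by auto
    moreover have "p 0 \<in> {0<..s+t+e}" using R s t by auto
    ultimately show ?L using R by (auto simp: not_le)
  qed
  ultimately show ?thesis by simp
qed

context prob_space
begin

text \<open>
  The renewal structure is used through the independence of the first point from the later gaps
  and through the antitone density of the first point. Emptiness of sets does not see multiplicities, so a delay that vanishes almost surely has
  to be excluded: the two copies then coincide and occupy the points of a Poisson process.
\<close>

lemma poisson_with_delayed_copies_not_renewal:
  fixes T Y :: "int \<Rightarrow> 'a \<Rightarrow> real"
  assumes T: "poisson_process r T"
    and indep: "indep_var (\<Pi>\<^sub>M i\<in>UNIV. borel) (\<lambda>\<omega> i. T i \<omega>) (\<Pi>\<^sub>M i\<in>UNIV. borel) (\<lambda>\<omega> i. Y i \<omega>)"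
    and Y: "iid Y D"
    and nonneg: "AE y in D. 0 \<le> y" and nonzero: "\<not> (AE y in D. y = 0)"
  shows "\<not> stationary_renewal_process (superposition T (secondary_arrivals T Y))"
proof
  assume "stationary_renewal_process (superposition T (secondary_arrivals T Y))"
  then obtain S G \<mu> where
      points: "AE \<omega> in M. successive_points (\<lambda>i. superposition T (secondary_arrivals T Y) i \<omega>) (\<lambda>k. S k \<omega>)"
    and gaps: "indep_vars (\<lambda>_. borel)
          (\<lambda>k \<omega>. case k of 0 \<Rightarrow> S 0 \<omega> | Suc j \<Rightarrow> S (Suc j) \<omega> - S j \<omega>) UNIV"
    and G: "real_distribution G" and \<mu>: "0 < \<mu>"
    and first: "distributed M lborel (S 0) (\<lambda>x. ennreal (indicator {0<..} x * ((1 - cdf G x) / \<mu>)))"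
    unfolding stationary_renewal_process_def by blast
  interpret G: real_distribution G by (rule G)
  have vec: "(\<lambda>\<omega> i. T i \<omega>) \<in> measurable M (\<Pi>\<^sub>M i\<in>UNIV. borel)"
    using indep by (auto simp: indep_var_distribution_eq)
  have [measurable]: "T i \<in> borel_measurable M" for i
    using vec by measurable
  have D: "\<And>i. distr M borel (Y i) = D" and Y_meas [measurable]: "\<And>i. Y i \<in> borel_measurable M"
    using Y by (auto simp: iid_def indep_vars_def)
  have sets_D: "sets D = sets borel"
    using D[of 0] by auto
  interpret D: nonneg_distribution D
    using prob_space_distr[OF Y_meas[of 0]] D sets_D nonneg
    by (simp add: nonneg_distribution_def nonneg_distribution_axioms_def real_distribution_def
        real_distribution_axioms_def)
  have gap_meas: "(\<lambda>\<omega>. case k of 0 \<Rightarrow> S 0 \<omega> | Suc j \<Rightarrow> S (Suc j) \<omega> - S j \<omega>) \<in> borel_measurable M" for k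
    using gaps by (simp add: indep_vars_def)
  have [measurable]: "S k \<in> borel_measurable M" for k
  proof (induction k)
    case 0
    then show ?case using gap_meas[of 0] by simp
  next
    case (Suc k)
    have "(\<lambda>\<omega>. (S (Suc k) \<omega> - S k \<omega>) + S k \<omega>) \<in> borel_measurable M"
      using gap_meas[of "Suc k"] Suc by (intro borel_measurable_add) auto
    then show ?case by simp
  qed
  define f where "f x = (1 - cdf G x) / \<mu>" for x
  have f_nonneg: "0 \<le> f x" for x
    using \<mu> G.cdf_bounded_prob by (simp add: f_def)
  have f_anti: "antimono f"
    using \<mu> G.cdf_nondecreasing by (auto simp: f_def monotone_def intro!: divide_right_mono)
  have f_right: "((\<lambda>e. f (s + e)) \<longlongrightarrow> f s) (at_right 0)" for s
  proof -
    have "(cdf G \<longlongrightarrow> cdf G s) (at_right s)"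
      using G.cdf_is_right_cont[of s] by (simp add: continuous_within)
    then have "((\<lambda>e. cdf G (s + e)) \<longlongrightarrow> cdf G s) (at_right 0)"
      by (subst (asm) filterlim_at_right_to_0) (simp add: add.commute)
    then show ?thesis
      unfolding f_def using \<mu> by (intro tendsto_intros) auto
  qed
  let ?A = "\<lambda>s t e. {\<omega>\<in>space M. S 0 \<omega> \<in> {s<..s+e} \<and> (\<forall>k. S k \<omega> \<notin> {s+e<..s+e+t})}"
  let ?V = "\<lambda>B. {\<omega>\<in>space M. \<forall>i. T i \<omega> \<notin> B \<and> T i \<omega> + Y i \<omega> \<notin> B}"
  define p where "p s t e = prob (?A s t e)" for s t e
  have "\<exists>I. (\<forall>s e. 0 \<le> s \<longrightarrow> 0 < e \<longrightarrow> f (s + e) * I e \<le> p s t e \<and> p s t e \<le> f s * I e)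
      \<and> (t = 0 \<longrightarrow> (\<forall>e>0. I e = e))" if t: "0 \<le> t" for t
    by (rule antitone_density_sandwich[OF gaps first[folded f_def] f_nonneg f_anti])
       (unfold p_def, blast)
  then obtain I where I: "\<And>t. 0 \<le> t \<Longrightarrow>
      (\<forall>s e. 0 \<le> s \<longrightarrow> 0 < e \<longrightarrow> f (s + e) * I t e \<le> p s t e \<and> p s t e \<le> f s * I t e)
      \<and> (t = 0 \<longrightarrow> (\<forall>e>0. I t e = e))"
    by metis
  have V1: "prob (?V {0<..x}) = D.interval_void_prob r x" if "0 \<le> x" for x
  proof -
    have "(\<integral>y. \<integral>u. indicator {0<..x} u * indicator {0<..x} (u + y) \<partial>lborel \<partial>D) = mean_overlap D x"
      unfolding mean_overlap_def using nonneg
      by (intro integral_cong_AE) (auto elim!: eventually_mono simp: overlap_interval)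
    then show ?thesis
      using void_probability[OF T indep Y, of "{0<..x}"] that
      by (simp add: D.interval_void_prob_def measure_lborel_Ioc)
  qed
  have V2: "prob (?V ({0<..s} \<union> {s+e<..s+e+t})) = D.two_interval_void_prob r s t e" if "0 \<le> s" "0 \<le> t" "0 \<le> e" for s t e
  proof -
    let ?B = "{0<..s} \<union> {s+e<..s+e+t}"
    have "measure lborel ?B = measure lborel {0<..s} + measure lborel {s+e<..s+e+t}"
      using that by (intro measure_Union emeasure_bounded_finite[THEN less_imp_neq]) auto
    then have len: "measure lborel ?B = s + t"
      using that by (simp add: measure_lborel_Ioc)
    have "(\<integral>y. \<integral>u. indicator ?B u * indicator ?B (u + y) \<partial>lborel \<partial>D)
        = (\<integral>y. max 0 (s - y) + max 0 (t - y)
      + (max 0 (s + t + e - y) - max 0 (s + e - y) - max 0 (t + e - y) + max 0 (e - y)) \<partial>D)"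
    proof (rule integral_cong_AE)
      show "AE y in D. (\<integral>u. indicator ?B u * indicator ?B (u + y) \<partial>lborel) = max 0 (s - y) + max 0 (t - y)
        + (max 0 (s + t + e - y) - max 0 (s + e - y) - max 0 (t + e - y) + max 0 (e - y))"
        using nonneg by eventually_elim (rule overlap_two_intervals[OF that])
    qed auto
    also have "\<dots> = mean_overlap D s + mean_overlap D t
      + (mean_overlap D (s + t + e) - mean_overlap D (s + e) - mean_overlap D (t + e) + mean_overlap D e)"
      unfolding mean_overlap_def using D.integrable_excess by simp
    finally show ?thesis
      using void_probability[OF T indep Y, of ?B] len
      by (simp add: D.two_interval_void_prob_def)
  qed
  have p_void: "p s t e = D.two_interval_void_prob r s t e - D.interval_void_prob r (s + t + e)"
    if s: "0 \<le> s" and t: "0 \<le> t" and e: "0 < e" for s t e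
  proof -
    let ?B = "{0<..s} \<union> {s+e<..s+e+t}" and ?L = "{0<..s+t+e}"
    have meas: "?V C \<in> events" if [measurable]: "C \<in> sets borel" for C
      by measurable
    have "AE \<omega> in M. \<omega> \<in> ?V ?B - ?V ?L \<longleftrightarrow> \<omega> \<in> ?A s t e"
      using points AE_space
    proof eventually_elim
      case (elim \<omega>)
      have eq: "(\<forall>i. superposition T (secondary_arrivals T Y) i \<omega> \<notin> C) \<longleftrightarrow> (\<forall>i. T i \<omega> \<notin> C \<and> T i \<omega> + Y i \<omega> \<notin> C)" for C
        by (auto simp: superposition_def secondary_arrivals_def split_sum_all)
      then show ?case
        using successive_points_first_point[OF elim(1) s t e, unfolded eq] elim(2)
        by (simp only: mem_Collect_eq Diff_iff simp_thms)
    qed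
    then have "prob (?V ?B - ?V ?L) = p s t e"
      unfolding p_def using meas by (intro finite_measure_eq_AE) auto
    moreover have "?B \<subseteq> ?L" using s t e by auto
    then have "?V ?L \<subseteq> ?V ?B" by blast
    then have "prob (?V ?B - ?V ?L) = prob (?V ?B) - prob (?V ?L)"
      by (intro finite_measure_Diff meas) auto
    ultimately show ?thesis
      using V1[of "s + t + e"] V2[of s t e] s t e by simp
  qed
  define d where "d s t = r * D.interval_void_prob r (s + t) * (2 - cdf D s - cdf D t + cdf D 0)" for s t
  have r: "0 < r" using T by (rule poisson_processD)
  have "d s t * d 0 0 = d s 0 * d 0 t" if "0 \<le> s" "0 \<le> t" for s t
  proof (rule sandwich_limit_product[where p = p and f = f and I = I and d = d, OF _ _ _ _ f_nonneg f_right that])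
    show "((\<lambda>e. p s t e / e) \<longlongrightarrow> d s t) (at_right 0)" if "0 \<le> s" "0 \<le> t" for s t
      unfolding d_def
      by (rule Lim_transform_eventually[OF D.void_difference_right_derivative])
         (use p_void that in \<open>auto simp: eventually_at_right_field intro!: exI[of _ 1]\<close>)
  qed (use I in auto)
  moreover have "D.interval_void_prob r 0 = 1"
    by (simp add: D.interval_void_prob_def D.mean_overlap_zero)
  ultimately have "r\<^sup>2 * (D.interval_void_prob r (s + t) * (2 - cdf D s - cdf D t + cdf D 0) * (2 - cdf D 0))
      = r\<^sup>2 * (D.interval_void_prob r s * (2 - cdf D s) * (D.interval_void_prob r t * (2 - cdf D t)))" if "0 \<le> s" "0 \<le> t" for s t
    using that by (simp add: d_def power2_eq_square mult_ac)
  then have product: "D.interval_void_prob r (s + t) * (2 - cdf D s - cdf D t + cdf D 0) * (2 - cdf D 0)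
      = D.interval_void_prob r s * (2 - cdf D s) * (D.interval_void_prob r t * (2 - cdf D t))" if "0 \<le> s" "0 \<le> t" for s t
    using r that by fastforce
  \<comment> \<open>The delay is non-negative, so it vanishes almost surely if it is non-positive almost surely.\<close>
  have "cdf D 0 \<noteq> 1"
  proof
    assume "cdf D 0 = 1"
    then have "AE y in D. y \<in> {..0}"
      by (intro D.AE_prob_1) (simp add: cdf_def)
    with nonneg have "AE y in D. y = 0" by eventually_elim auto
    with nonzero show False ..
  qed
  then have "cdf D 0 < 1" using D.cdf_bounded_prob[of 0] by simp
  then show False by (rule D.void_product_impossible[OF r _ product])
qed

end

section \<open>The two arrival streams of the queue\<close>

text \<open>
  Discarding the service times from the second sigma-algebra leaves that of the primary epochs.
\<close>

lemma (in MTG1_queue) delays_indep_of_primary: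
  "indep_var (\<Pi>\<^sub>M i\<in>UNIV. borel) (\<lambda>\<omega> i. T i \<omega>) (\<Pi>\<^sub>M i\<in>UNIV. borel) (\<lambda>\<omega> i. Y i \<omega>)"
proof -
  let ?P = "\<Pi>\<^sub>M i\<in>(UNIV :: int set). (borel :: real measure)"
  let ?Z = "\<lambda>\<omega>. (\<lambda>i. T i \<omega>, \<lambda>i. U i \<omega>, \<lambda>i. V i \<omega>)"
  let ?A = "sets (vimage_algebra (space M) (\<lambda>\<omega> i. Y i \<omega>) ?P)"
  let ?B = "sets (vimage_algebra (space M) ?Z (?P \<Otimes>\<^sub>M ?P \<Otimes>\<^sub>M ?P))"
  have A: "?A \<subseteq> events" and B: "?B \<subseteq> events"
    and prod: "\<And>a b. a \<in> ?A \<Longrightarrow> b \<in> ?B \<Longrightarrow> prob (a \<inter> b) = prob a * prob b"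
    using delay_indep by (auto simp: indep_sets2_eq)
  have genA: "(\<lambda>\<omega> i. Y i \<omega>) -` C \<inter> space M \<in> ?A" if "C \<in> sets ?P" for C
    using that by (rule in_vimage_algebra)
  have genB: "(\<lambda>\<omega> i. T i \<omega>) -` C \<inter> space M \<in> ?B" if C: "C \<in> sets ?P" for C
  proof -
    have "C \<times> (space (?P \<Otimes>\<^sub>M ?P)) \<in> sets (?P \<Otimes>\<^sub>M ?P \<Otimes>\<^sub>M ?P)"
      using C by (intro pair_measureI) auto
    from in_vimage_algebra[OF this, of ?Z "space M"]
    show ?thesis by (simp add: vimage_def space_pair_measure space_PiM)
  qed
  have sigA: "sigma_sets (space M) {(\<lambda>\<omega> i. Y i \<omega>) -` C \<inter> space M | C. C \<in> sets ?P} \<subseteq> ?A"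
    using sets.sigma_sets_subset[of "{(\<lambda>\<omega> i. Y i \<omega>) -` C \<inter> space M | C. C \<in> sets ?P}"
        "vimage_algebra (space M) (\<lambda>\<omega> i. Y i \<omega>) ?P"] genA by auto
  have sigB: "sigma_sets (space M) {(\<lambda>\<omega> i. T i \<omega>) -` C \<inter> space M | C. C \<in> sets ?P} \<subseteq> ?B"
    using sets.sigma_sets_subset[of "{(\<lambda>\<omega> i. T i \<omega>) -` C \<inter> space M | C. C \<in> sets ?P}"
        "vimage_algebra (space M) ?Z (?P \<Otimes>\<^sub>M ?P \<Otimes>\<^sub>M ?P)"] genB by auto
  have "(\<lambda>\<omega> i. T i \<omega>) \<in> measurable M ?P" "(\<lambda>\<omega> i. Y i \<omega>) \<in> measurable M ?P"
    using genA genB A B by (auto intro!: measurableI simp: space_PiM)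
  moreover have "indep_set (sigma_sets (space M) {(\<lambda>\<omega> i. T i \<omega>) -` C \<inter> space M | C. C \<in> sets ?P})
      (sigma_sets (space M) {(\<lambda>\<omega> i. Y i \<omega>) -` C \<inter> space M | C. C \<in> sets ?P})"
    unfolding indep_sets2_eq
  proof (intro conjI ballI)
    fix a b
    assume "a \<in> sigma_sets (space M) {(\<lambda>\<omega> i. T i \<omega>) -` C \<inter> space M | C. C \<in> sets ?P}"
      and "b \<in> sigma_sets (space M) {(\<lambda>\<omega> i. Y i \<omega>) -` C \<inter> space M | C. C \<in> sets ?P}"
    then show "prob (a \<inter> b) = prob a * prob b"
      using prod[of b a] sigA sigB by (auto simp: Int_commute mult.commute)
  qed (use A B sigA sigB in blast)+
  ultimately show ?thesis
    unfolding indep_var_eq by blast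
qed

theorem lemma1:
  fixes M :: "'a measure"
    and rate :: real
    and T Y U V :: "int \<Rightarrow> 'a \<Rightarrow> real"
    and F\<^sub>Y F\<^sub>U F\<^sub>V :: "real measure"
  assumes queue: "MTG1_queue M rate T Y U V F\<^sub>Y F\<^sub>U F\<^sub>V"
    and nondegenerate: "\<not> (\<exists>c. AE y in F\<^sub>Y. y = c)"
  shows "prob_space.poisson_process M rate T \<and>
         prob_space.poisson_process M rate (secondary_arrivals T Y) \<and>
         \<not> prob_space.stationary_renewal_process M (superposition T (secondary_arrivals T Y))"
proof -
  interpret MTG1_queue M rate T Y U V F\<^sub>Y F\<^sub>U F\<^sub>V by (rule queue)
  have "secondary_arrivals T Y = (\<lambda>i \<omega>. T i \<omega> + Y i \<omega>)"
    by (simp add: secondary_arrivals_def fun_eq_iff)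
  then have "poisson_process rate (secondary_arrivals T Y)"
    using displaced_poisson_process[OF primary delays_indep_of_primary delay_iid] by simp
  moreover have "\<not> stationary_renewal_process (superposition T (secondary_arrivals T Y))"
    using nondegenerate
    by (intro poisson_with_delayed_copies_not_renewal[OF primary delays_indep_of_primary delay_iid delay_nonneg]) blast
  ultimately show ?thesis using primary by blast
qed

end
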